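(* Let $m_1,m_2,m_3,m_4\ge3$ be odd integers and $a,b,c,d$ non-zero rational numbers. Consider the hyperelliptic curves $$E_1:y^2=x^{m_1}+a^2,\quad E_2:y^2=x^{m_2}+b^2,\quad E_3:y^2=x^{m_3}+c^2,\quad E_4:y^2=x^{m_4}+d.$$ Then there exists a rational function $D\in\mathbb{Q}(u,v_1,v_2,v_3)$ such that the Jacobians of the curves $$y^2=Dx^{m_1}+a^2,\quad y^2=Dx^{m_2}+b^2,\quad y^2=Dx^{m_3}+c^2,\quad y^2=x^{m_4}+dD$$ all have positive Mordell–Weil rank over $\mathbb{Q}(u,v_1,v_2,v_3)$.
   Context: $\mathbb{Q}(u,v_1,v_2,v_3)$ is the rational function field in four independent variables. For a rational function $D$, the $m$-twist of $y^2=x^m+\alpha$ by $D$ is $y^2=Dx^m+\alpha$, and the $2m$-twist of $y^2=x^m+\alpha$ by $D$ is $y^2=x^m+\alpha D$. *)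

theory Defs
  imports
    "HOL-Algebra.Algebraic_Closure_Type"
    "HOL-Algebra.Free_Abelian_Groups"
    "HOL-Algebra.Coset"
    "HOL-Library.Extended_Nat"
begin

text \<open>
  Throughout, a polynomial \<open>F\<close> over a field stands for the smooth projective model of the
  hyperelliptic curve \<open>y\<^sup>2 = F(x)\<close>. The definitions are meant for squarefree \<open>F\<close> of odd degree
  \<open>\<ge> 3\<close> in characteristic 0; then the model is the affine curve, which is smooth, together with
  exactly one point at infinity.
\<close>

datatype 'a hpoint = Infinity | Affine 'a 'a

definition curve_points :: "'a::field poly \<Rightarrow> 'a hpoint set" where
  "curve_points F = insert Infinity {Affine x y | x y. y ^ 2 = poly F x}"

text \<open>
  An element \<open>p(x) + q(x) y\<close> of the coordinate ring \<open>k[x, y] / (y\<^sup>2 - F(x))\<close> is represented by the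
  pair \<open>(p, q)\<close>. Bivariate polynomials are elements of \<open>k[x][y]\<close>: the outer variable is \<open>y\<close>.
\<close>

type_synonym 'a coord_fun = "'a poly \<times> 'a poly"

definition bivariate :: "'a::field coord_fun \<Rightarrow> 'a poly poly" where
  "bivariate g = [:fst g, snd g:]"

definition curve_eqn :: "'a::field poly \<Rightarrow> 'a poly poly" where
  "curve_eqn F = [:- F, 0, 1:]"

text \<open>
  Membership of \<open>g\<close> in the \<open>n\<close>-th power of the maximal ideal \<open>(x - x0, y - y0)\<close> of the coordinate
  ring, pulled back to \<open>k[x][y]\<close>. This power is generated by the products
  \<open>(x - x0)\<^sup>i (y - y0)\<^sup>n\<^sup>-\<^sup>i\<close>.
\<close>

definition in_max_ideal_power ::
    "'a::field poly \<Rightarrow> 'a \<Rightarrow> 'a \<Rightarrow> nat \<Rightarrow> 'a coord_fun \<Rightarrow> bool" where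
  "in_max_ideal_power F x0 y0 n g \<longleftrightarrow>
     (\<exists>(c :: nat \<Rightarrow> 'a poly poly) (r :: 'a poly poly).
        bivariate g =
          (\<Sum>i\<le>n. c i * [:[:- x0, 1:]:] ^ i * [:[:- y0:], 1:] ^ (n - i)) + r * curve_eqn F)"

text \<open>
  Order of vanishing of a non-zero \<open>g = p + q y\<close> at a point. At infinity: the norm
  \<open>N = p\<^sup>2 - F q\<^sup>2\<close> is the product of \<open>g\<close> and its conjugate \<open>p - q y\<close>, which have the same order at
  infinity since the hyperelliptic involution fixes that point; \<open>x\<close> has a double pole there, so
  \<open>N\<close> has order \<open>- 2 deg N\<close>.
\<close>

fun ord_at :: "'a::field poly \<Rightarrow> 'a hpoint \<Rightarrow> 'a coord_fun \<Rightarrow> int" where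
  "ord_at F (Affine x0 y0) g = int (GREATEST n. in_max_ideal_power F x0 y0 n g)"
| "ord_at F Infinity g = - int (Polynomial.degree (fst g ^ 2 - F * snd g ^ 2))"

definition divisor_degree :: "('p \<Rightarrow>\<^sub>0 int) \<Rightarrow> int" where
  "divisor_degree \<Delta> = (\<Sum>P\<in>Poly_Mapping.keys \<Delta>. Poly_Mapping.lookup \<Delta> P)"

definition Div0 :: "'a::field poly \<Rightarrow> ('a hpoint \<Rightarrow>\<^sub>0 int) monoid" where
  "Div0 F = (free_Abelian_group (curve_points F))
     \<lparr>carrier := {\<Delta> \<in> carrier (free_Abelian_group (curve_points F)). divisor_degree \<Delta> = 0}\<rparr>"

text \<open>
  Divisors of the non-zero rational functions \<open>g / h\<close>. Over an algebraically closed field they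
  automatically have degree 0, so taking them inside \<open>Div0\<close> excludes nothing.
\<close>

definition principal_divisors :: "'a::field poly \<Rightarrow> ('a hpoint \<Rightarrow>\<^sub>0 int) set" where
  "principal_divisors F =
     {\<Delta> \<in> carrier (Div0 F). \<exists>g h. g \<noteq> (0, 0) \<and> h \<noteq> (0, 0) \<and>
        (\<forall>P\<in>curve_points F. Poly_Mapping.lookup \<Delta> P = ord_at F P g - ord_at F P h)}"

text \<open>To be used over an algebraically closed field, where all closed points have degree 1.\<close>

definition Pic0 :: "'a::field poly \<Rightarrow> ('a hpoint \<Rightarrow>\<^sub>0 int) set monoid" where
  "Pic0 F = Div0 F Mod principal_divisors F"

definition galois_automorphisms :: "('k::field alg_closure \<Rightarrow> 'k alg_closure) set" where
  "galois_automorphisms = {\<sigma>. bij \<sigma> \<and> (\<forall>x y. \<sigma> (x + y) = \<sigma> x + \<sigma> y) \<and>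
     (\<forall>x y. \<sigma> (x * y) = \<sigma> x * \<sigma> y) \<and> (\<forall>c. \<sigma> (to_ac c) = to_ac c)}"

definition divisor_map :: "('a \<Rightarrow> 'a) \<Rightarrow> ('a hpoint \<Rightarrow>\<^sub>0 int) \<Rightarrow> ('a hpoint \<Rightarrow>\<^sub>0 int)" where
  "divisor_map \<sigma> = frag_extend (\<lambda>P. frag_of (map_hpoint \<sigma> P))"

text \<open>
  The group \<open>J(k)\<close> of \<open>k\<close>-rational points of the Jacobian of \<open>y\<^sup>2 = f(x)\<close>: the Galois-invariant
  divisor classes of degree 0 over the algebraic closure of \<open>k\<close> (\<open>k\<close> perfect). A class is a coset,
  so Galois acts on it by taking images.
\<close>

definition jacobian_points ::
    "'k::field poly \<Rightarrow> ('k alg_closure hpoint \<Rightarrow>\<^sub>0 int) set monoid" where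
  "jacobian_points f = (Pic0 (map_poly to_ac f))
     \<lparr>carrier := {\<xi> \<in> carrier (Pic0 (map_poly to_ac f)).
                    \<forall>\<sigma>\<in>galois_automorphisms. divisor_map \<sigma> ` \<xi> = \<xi>}\<rparr>"

text \<open>
  The rank of an abelian group \<open>G\<close>, i.e. the dimension of \<open>G \<otimes> \<rat>\<close>, is the maximal number of
  elements that are linearly independent over the integers.
\<close>

definition int_independent :: "('g, 'b) monoid_scheme \<Rightarrow> 'g set \<Rightarrow> bool" where
  "int_independent G S \<longleftrightarrow> finite S \<and> S \<subseteq> carrier G \<and>
     (\<forall>c :: 'g \<Rightarrow> int.
        finprod G (\<lambda>s. s [^]\<^bsub>G\<^esub> c s) S = \<one>\<^bsub>G\<^esub> \<longrightarrow> (\<forall>s\<in>S. c s = 0))"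

definition abelian_rank :: "('g, 'b) monoid_scheme \<Rightarrow> enat" where
  "abelian_rank G = (SUP S\<in>{S. int_independent G S}. enat (card S))"

definition mordell_weil_rank :: "'k::field poly \<Rightarrow> enat" where
  "mordell_weil_rank f = abelian_rank (jacobian_points f)"

text \<open>The field \<open>\<rat>(u, v\<^sub>1, v\<^sub>2, v\<^sub>3)\<close>, as the fraction field of \<open>\<rat>[u][v\<^sub>1][v\<^sub>2][v\<^sub>3]\<close>.\<close>

type_synonym ratfun4 = "rat poly poly poly poly fract"

definition rat_const :: "rat \<Rightarrow> ratfun4" where
  "rat_const a = to_fract [:[:[:[:a:]:]:]:]"

text \<open>The right-hand sides of \<open>y\<^sup>2 = D x\<^sup>m + \<alpha>\<close> and \<open>y\<^sup>2 = x\<^sup>m + \<alpha> D\<close>.\<close>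

definition m_twist :: "nat \<Rightarrow> 'k::field \<Rightarrow> 'k \<Rightarrow> 'k poly" where
  "m_twist m \<alpha> D = Polynomial.monom D m + [:\<alpha>:]"

definition two_m_twist :: "nat \<Rightarrow> 'k::field \<Rightarrow> 'k \<Rightarrow> 'k poly" where
  "two_m_twist m \<alpha> D = Polynomial.monom 1 m + [:\<alpha> * D:]"

end

theory Submission
  imports Defs
begin

text \<open>
  If \<open>n (P - \<infinity>)\<close> is principal for a point \<open>P = (x0, y0)\<close> with \<open>y0 \<noteq> 0\<close>, then the Pell equation
  \<open>p\<^sup>2 - f q\<^sup>2 = c (x - x0)\<^sup>n\<close> has a solution, not divisible by \<open>x - x0\<close>, over the algebraic closure,
  and by linear algebra also over \<open>K\<close> itself. Over \<open>K\<close> such a solution \<open>g = p + q y\<close> is excluded by a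
  derivation \<open>\<delta>\<close> of \<open>K(x, y)\<close> that does not raise degrees in \<open>x\<close> and multiplies \<open>f\<close> by a constant: the
  only possible pole of \<open>\<delta>(g) / g\<close> is a simple one at \<open>P\<close>, and on a curve of positive genus there is no
  function with exactly one simple pole. For \<open>f = A x\<^sup>m + B\<close> the pole is really there as soon as
  \<open>y0\<^sup>2 / B\<close> is not killed by the derivation of \<open>K\<close>.

  The twist comes from doubling the point \<open>(0, 1)\<close> on
  \<open>Y\<^sup>2 = (1 + p X) (1 + q X) (1 + s X)\<close> with \<open>p = 1 / a\<^sup>2\<close>, \<open>q = 1 / b\<^sup>2\<close>, \<open>s = v\<^sub>3^(2 m\<^sub>3) / c\<^sup>2\<close>.
  As \<open>p\<close>, \<open>q\<close>, \<open>s\<close> are squares, all three factors are squares at the abscissa \<open>D'\<close> of the double.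
  Let \<open>w = d D' + 1\<close>, \<open>D = D' / w^M\<close> with \<open>M\<close> odd and divisible by all \<open>m\<^sub>i\<close>. Rescaling \<open>x\<close> by a power of
  \<open>w\<close> keeps the three points, and \<open>(1 / w^(M / m\<^sub>4))^m\<^sub>4 + d D = w^(1 - M)\<close> is a square.
\<close>

section \<open>Orders of vanishing\<close>

text \<open>The preimage in a ring of the \<open>n\<close>-th power of the ideal
  \<open>(U, V)\<close> of its quotient by \<open>E\<close>. With \<open>U = x - x0\<close>,
  \<open>V = y - y0\<close> and the curve equation as \<open>E\<close> this is the set behind
  \<open>in_max_ideal_power\<close>; arbitrary ring elements keep the arithmetic of such powers free
  of nested polynomials.\<close>

definition ideal_power :: "'r::comm_ring_1 \<Rightarrow> 'r \<Rightarrow> 'r \<Rightarrow> nat \<Rightarrow> 'r set" where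
  "ideal_power U V E n = {b. \<exists>c r. b = (\<Sum>i\<le>n. c i * U ^ i * V ^ (n - i)) + r * E}"

lemma ideal_powerI: "b = (\<Sum>i\<le>n. c i * U ^ i * V ^ (n - i)) + r * E \<Longrightarrow> b \<in> ideal_power U V E n"
  by (auto simp: ideal_power_def)

lemma ideal_powerE:
  assumes "b \<in> ideal_power U V E n"
  obtains c r where "b = (\<Sum>i\<le>n. c i * U ^ i * V ^ (n - i)) + r * E"
  using assms by (auto simp: ideal_power_def)

lemma ideal_power_add:
  assumes "a \<in> ideal_power U V E n" "b \<in> ideal_power U V E n"
  shows "a + b \<in> ideal_power U V E n"
proof -
  obtain c r where a: "a = (\<Sum>i\<le>n. c i * U ^ i * V ^ (n - i)) + r * E"
    using assms(1) by (rule ideal_powerE)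
  obtain c' r' where b: "b = (\<Sum>i\<le>n. c' i * U ^ i * V ^ (n - i)) + r' * E"
    using assms(2) by (rule ideal_powerE)
  show ?thesis
    by (rule ideal_powerI[where c = "\<lambda>i. c i + c' i" and r = "r + r'"])
      (simp add: a b sum.distrib algebra_simps)
qed

lemma ideal_power_mult_left:
  assumes "b \<in> ideal_power U V E n"
  shows "a * b \<in> ideal_power U V E n"
proof -
  obtain c r where b: "b = (\<Sum>i\<le>n. c i * U ^ i * V ^ (n - i)) + r * E"
    using assms by (rule ideal_powerE)
  show ?thesis
    by (rule ideal_powerI[where c = "\<lambda>i. a * c i" and r = "a * r"])
      (simp add: b sum_distrib_left algebra_simps)
qed

lemma ideal_power_sum:
  assumes "\<And>i. i \<in> A \<Longrightarrow> f i \<in> ideal_power U V E n"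
  shows "sum f A \<in> ideal_power U V E n"
proof -
  have "0 \<in> ideal_power U V E n"
    by (rule ideal_powerI[where c = "\<lambda>_. 0" and r = 0]) simp
  thus ?thesis
    using assms by (induction A rule: infinite_finite_induct) (auto intro: ideal_power_add)
qed

lemma ideal_power_diff:
  assumes "a \<in> ideal_power U V E n" "b \<in> ideal_power U V E n"
  shows "a - b \<in> ideal_power U V E n"
  using ideal_power_add[OF assms(1) ideal_power_mult_left[OF assms(2), of "-1"]] by simp

lemma ideal_power_relation: "r * E \<in> ideal_power U V E n"
  by (rule ideal_powerI[where c = "\<lambda>_. 0" and r = r]) simp

lemma ideal_power_generator:
  assumes "i \<le> n"
  shows "U ^ i * V ^ (n - i) \<in> ideal_power U V E n"
  by (rule ideal_powerI[where c = "\<lambda>j. if j = i then 1 else 0" and r = 0])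
    (use assms in \<open>simp add: if_distrib[of "\<lambda>z. z * _"] cong: if_cong\<close>)

lemma ideal_power_mult:
  assumes "a \<in> ideal_power U V E k" "b \<in> ideal_power U V E l"
  shows "a * b \<in> ideal_power U V E (k + l)"
proof -
  obtain c r where a: "a = (\<Sum>i\<le>k. c i * U ^ i * V ^ (k - i)) + r * E"
    using assms(1) by (rule ideal_powerE)
  obtain c' r' where b: "b = (\<Sum>j\<le>l. c' j * U ^ j * V ^ (l - j)) + r' * E"
    using assms(2) by (rule ideal_powerE)
  define A B where "A = (\<Sum>i\<le>k. c i * U ^ i * V ^ (k - i))"
    and "B = (\<Sum>j\<le>l. c' j * U ^ j * V ^ (l - j))"
  have "A * B = (\<Sum>i\<le>k. \<Sum>j\<le>l. (c i * c' j) * (U ^ (i + j) * V ^ (k + l - (i + j))))"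
    unfolding A_def B_def sum_product
  proof (intro sum.cong refl)
    fix i j assume "i \<in> {..k}" "j \<in> {..l}"
    hence "k + l - (i + j) = (k - i) + (l - j)" by auto
    thus "c i * U ^ i * V ^ (k - i) * (c' j * U ^ j * V ^ (l - j)) =
        c i * c' j * (U ^ (i + j) * V ^ (k + l - (i + j)))"
      by (simp only: power_add mult_ac)
  qed
  also have "\<dots> \<in> ideal_power U V E (k + l)"
    by (intro ideal_power_sum ideal_power_mult_left ideal_power_generator) auto
  finally have "A * B + (A * r' + r * B + r * r' * E) * E \<in> ideal_power U V E (k + l)"
    by (intro ideal_power_add ideal_power_relation)
  moreover have "a * b = A * B + (A * r' + r * B + r * r' * E) * E"
    unfolding a b A_def[symmetric] B_def[symmetric] by (simp add: algebra_simps)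
  ultimately show ?thesis by simp
qed

lemma ideal_power_0 [simp]: "b \<in> ideal_power U V E 0"
  by (rule ideal_powerI[where c = "\<lambda>_. b" and r = 0]) simp

lemma ideal_power_1I: "U * a + V * b \<in> ideal_power U V E 1"
  by (rule ideal_powerI[where c = "\<lambda>i. if i = 0 then b else a" and r = 0]) (simp add: algebra_simps)

lemma ideal_power_antimono:
  assumes "b \<in> ideal_power U V E n" "k \<le> n"
  shows "b \<in> ideal_power U V E k"
proof -
  have gen: "U ^ i * V ^ (n - i) \<in> ideal_power U V E k" if "i \<le> n" for i
  proof (cases "i \<le> k")
    case True
    hence "n - i = (n - k) + (k - i)" using \<open>k \<le> n\<close> by simp
    hence "U ^ i * V ^ (n - i) = V ^ (n - k) * (U ^ i * V ^ (k - i))"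
      by (simp add: power_add)
    thus ?thesis using True by (simp only: ideal_power_mult_left ideal_power_generator)
  next
    case False
    hence "i = (i - k) + k" by simp
    hence "U ^ i = U ^ (i - k) * U ^ k" by (metis power_add)
    hence "U ^ i * V ^ (n - i) = (U ^ (i - k) * V ^ (n - i)) * (U ^ k * V ^ (k - k))"
      by (simp add: mult_ac)
    thus ?thesis by (simp only: ideal_power_mult_left ideal_power_generator order_refl)
  qed
  obtain c r where b: "b = (\<Sum>i\<le>n. c i * U ^ i * V ^ (n - i)) + r * E"
    using assms(1) by (rule ideal_powerE)
  have "(\<Sum>i\<le>n. c i * (U ^ i * V ^ (n - i))) + r * E \<in> ideal_power U V E k"
    by (intro ideal_power_add ideal_power_sum ideal_power_mult_left ideal_power_relation gen) auto
  thus ?thesis by (simp add: b mult.assoc)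
qed

text \<open>Modulo \<open>(U, V)\<close> the factor \<open>e\<close> is the unit \<open>u\<close>,
  so it is invertible modulo every power of that ideal. The induction shows this without localising:
  if \<open>b\<close> lies in the \<open>k\<close>-th power and \<open>k < n\<close>, then
  \<open>u * b = b * e - (U * e1 + V * e2) * b\<close> lies in the next one.\<close>

lemma ideal_power_cancel_unit:
  assumes be: "b * e \<in> ideal_power U V E n"
    and e: "e = u + U * e1 + V * e2" and u: "u * u' = 1"
  shows "b \<in> ideal_power U V E n"
proof -
  have "b \<in> ideal_power U V E k" if "k \<le> n" for k
    using that
  proof (induction k)
    case (Suc k)
    have "(U * e1 + V * e2) * b \<in> ideal_power U V E (1 + k)"
      using Suc by (intro ideal_power_mult ideal_power_1I) auto
    moreover have "b * e \<in> ideal_power U V E (1 + k)"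
      using ideal_power_antimono[OF be] Suc.prems by simp
    ultimately have "u' * (b * e - (U * e1 + V * e2) * b) \<in> ideal_power U V E (1 + k)"
      by (intro ideal_power_mult_left[of _ _ _ _ _ u'] ideal_power_diff)
    moreover have "u' * (b * e - (U * e1 + V * e2) * b) = (u * u') * b"
      by (simp add: e algebra_simps)
    ultimately show ?case by (simp add: u)
  qed simp
  thus ?thesis by simp
qed

lemma in_max_ideal_power_iff:
  "in_max_ideal_power F x0 y0 n g \<longleftrightarrow>
     bivariate g \<in> ideal_power [:[:- x0, 1:]:] [:[:- y0:], 1:] (curve_eqn F) n"
  by (auto simp: in_max_ideal_power_def ideal_power_def)

section \<open>Coefficient maps on polynomials, and square roots modulo powers of
  \<open>x - x0\<close>\<close>

lemma map_poly_add_hom: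
  assumes "h 0 = 0" "\<And>x y. h (x + y) = h x + h y"
  shows "map_poly h (p + q) = map_poly h p + map_poly h q"
  by (rule poly_eqI) (simp add: coeff_map_poly assms)

lemma sum_hom:
  assumes "h 0 = 0" "\<And>x y. h (x + y) = h x + h y"
  shows "h (sum f A) = (\<Sum>i\<in>A. h (f i))"
  by (induction A rule: infinite_finite_induct) (auto simp: assms)

lemma map_poly_mult_hom:
  assumes "h 0 = 0" "\<And>x y. h (x + y) = h x + h y" "\<And>x y. h (x * y) = h x * h y"
  shows "map_poly h (p * q) = map_poly h p * map_poly h q"
  by (rule poly_eqI) (simp add: coeff_map_poly coeff_mult assms sum_hom[of h])

lemma poly_map_poly_hom:
  assumes "h 0 = 0" "\<And>x y. h (x + y) = h x + h y" "\<And>x y. h (x * y) = h x * h y"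
  shows "poly (map_poly h p) (h x) = h (poly p x)"
  by (induction p) (auto simp: map_poly_pCons assms)

lemma linear_dvd_iff: "[:-a, 1:] dvd p \<longleftrightarrow> poly p a = (0::'a::comm_ring_1)"
  by (simp add: poly_eq_0_iff_dvd)

lemma linear_power_dvd_cancel:
  fixes p q :: "'a::idom poly"
  assumes "[:-a, 1:] ^ n dvd p * q" "poly p a \<noteq> 0"
  shows "[:-a, 1:] ^ n dvd q"
  using assms(1)
proof (induction n arbitrary: q)
  case (Suc n)
  have "[:-a, 1:] dvd p * q"
    using Suc.prems by (rule dvd_trans[rotated]) (simp only: power_Suc dvd_triv_left)
  hence "poly q a = 0" using assms(2) by (simp add: linear_dvd_iff)
  then obtain r where r: "q = [:-a, 1:] * r" by (auto simp: linear_dvd_iff[symmetric] elim: dvdE)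
  have "[:-a, 1:] * [:-a, 1:] ^ n dvd [:-a, 1:] * (p * r)"
    using Suc.prems by (simp only: r power_Suc mult.left_commute)
  hence "[:-a, 1:] ^ n dvd p * r"
    by (subst (asm) dvd_mult_cancel_left) auto
  hence "[:-a, 1:] ^ n dvd r" by (rule Suc.IH)
  thus ?case unfolding r power_Suc by (intro mult_dvd_mono) auto
qed simp

text \<open>Hensel lifting: a square root modulo \<open>(x - x0)^n\<close> is corrected by a
  multiple of \<open>(x - x0)^n\<close>, which works because \<open>2 * y0\<close> is
  invertible.\<close>

lemma sqrt_poly_mod_exists:
  fixes f :: "'a::field_char_0 poly"
  assumes y0: "y0 ^ 2 = poly f x0" "y0 \<noteq> 0"
  shows "\<exists>S. poly S x0 = y0 \<and> [:-x0, 1:] ^ n dvd f - S ^ 2"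
proof (induction n)
  case 0
  show ?case by (rule exI[of _ "[:y0:]"]) simp
next
  case (Suc n)
  then obtain S where S: "poly S x0 = y0" "[:-x0, 1:] ^ n dvd f - S ^ 2" by blast
  \<comment> \<open>For \<open>n = 0\<close> the correction would be a constant and would change the
    value at \<open>x0\<close>. The exponent 1 is therefore reached directly, by the constant
    \<open>y0\<close>.\<close>
  show ?case
  proof (cases "n = 0")
    case True
    thus ?thesis using y0 by (intro exI[of _ "[:y0:]"]) (simp add: linear_dvd_iff)
  next
    case n: False
    obtain R where R: "f - S ^ 2 = [:-x0, 1:] ^ n * R" using S(2) by (rule dvdE)
    \<comment> \<open>With this \<open>e\<close> the polynomial \<open>R - 2 e S\<close> vanishes at
      \<open>x0\<close>. The remaining term \<open>e^2 T\<close> vanishes there because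
      \<open>n > 0\<close>.\<close>
    define e where "e = poly R x0 / (2 * y0)"
    define T where "T = [:-x0, 1:] ^ n"
    define S' where "S' = S + smult e T"
    have "f - S' ^ 2 = T * (R - smult e (2 * S) - smult (e ^ 2) T)"
      using R by (simp add: S'_def T_def[symmetric] power2_eq_square algebra_simps)
    moreover have "[:-x0, 1:] dvd R - smult e (2 * S) - smult (e ^ 2) T"
      using n y0(2) S(1) by (simp add: linear_dvd_iff e_def T_def)
    ultimately have "[:-x0, 1:] ^ Suc n dvd f - S' ^ 2"
      by (simp only: T_def power_Suc2 mult_dvd_mono dvd_refl)
    moreover have "poly S' x0 = y0"
      using n S(1) by (simp add: S'_def T_def)
    ultimately show ?thesis by blast
  qed
qed

section \<open>Products and norms in the coordinate ring\<close>

definition coord_mult :: "'a::field poly \<Rightarrow> 'a coord_fun \<Rightarrow> 'a coord_fun \<Rightarrow> 'a coord_fun" where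
  "coord_mult F g h = (fst g * fst h + F * snd g * snd h, fst g * snd h + snd g * fst h)"

definition curve_norm :: "'a::field poly \<Rightarrow> 'a coord_fun \<Rightarrow> 'a poly" where
  "curve_norm F g = fst g ^ 2 - F * snd g ^ 2"

lemma curve_norm_mult: "curve_norm F (coord_mult F g h) = curve_norm F g * curve_norm F h"
  by (simp add: curve_norm_def coord_mult_def power2_eq_square algebra_simps)

text \<open>If both terms are non-zero, \<open>p^2\<close> has even and \<open>F q^2\<close> has odd
  degree, so their leading terms cannot cancel.\<close>

lemma degree_curve_norm:
  fixes p q :: "'a::field poly"
  assumes "odd (Polynomial.degree F)" "(p, q) \<noteq> (0, 0)"
  shows "p ^ 2 - F * q ^ 2 \<noteq> 0"
    "2 * Polynomial.degree p \<le> Polynomial.degree (p ^ 2 - F * q ^ 2)"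
    "q \<noteq> 0 \<Longrightarrow> 2 * Polynomial.degree q + Polynomial.degree F \<le> Polynomial.degree (p ^ 2 - F * q ^ 2)"
proof -
  have F: "F \<noteq> 0" using assms(1) by auto
  have dp: "Polynomial.degree (p ^ 2) = 2 * Polynomial.degree p"
    by (cases "p = 0") (simp_all add: degree_power_eq)
  have dq: "Polynomial.degree (F * q ^ 2) = Polynomial.degree F + 2 * Polynomial.degree q" if "q \<noteq> 0"
    using that F by (simp add: degree_mult_eq degree_power_eq)
  have "p ^ 2 - F * q ^ 2 \<noteq> 0 \<and>
      2 * Polynomial.degree p \<le> Polynomial.degree (p ^ 2 - F * q ^ 2) \<and>
      (q \<noteq> 0 \<longrightarrow> 2 * Polynomial.degree q + Polynomial.degree F \<le> Polynomial.degree (p ^ 2 - F * q ^ 2))"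
  proof (cases "q = 0")
    case True
    thus ?thesis using assms(2) dp by simp
  next
    case False
    have ne: "Polynomial.degree (p ^ 2) \<noteq> Polynomial.degree (F * q ^ 2)"
      using assms(1) by (auto simp: dp dq[OF False]) presburger
    show ?thesis
    proof (cases "Polynomial.degree (p ^ 2) < Polynomial.degree (F * q ^ 2)")
      case True
      hence "Polynomial.degree (p ^ 2 - F * q ^ 2) = Polynomial.degree (F * q ^ 2)"
        using degree_add_eq_right[of "p ^ 2" "- (F * q ^ 2)"] by simp
      moreover have "p ^ 2 - F * q ^ 2 \<noteq> 0" using True by auto
      ultimately show ?thesis using True by (simp add: dp dq[OF False])
    next
      case *: False
      hence less: "Polynomial.degree (F * q ^ 2) < Polynomial.degree (p ^ 2)" using ne by simp
      hence "Polynomial.degree (p ^ 2 - F * q ^ 2) = Polynomial.degree (p ^ 2)"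
        using degree_add_eq_left[of "- (F * q ^ 2)" "p ^ 2"] by simp
      moreover have "p ^ 2 - F * q ^ 2 \<noteq> 0" using less by auto
      ultimately show ?thesis using less by (simp add: dp dq[OF False])
    qed
  qed
  thus "p ^ 2 - F * q ^ 2 \<noteq> 0"
    "2 * Polynomial.degree p \<le> Polynomial.degree (p ^ 2 - F * q ^ 2)"
    "q \<noteq> 0 \<Longrightarrow> 2 * Polynomial.degree q + Polynomial.degree F \<le> Polynomial.degree (p ^ 2 - F * q ^ 2)"
    by auto
qed

lemma curve_norm_nonzero:
  assumes "odd (Polynomial.degree F)" "g \<noteq> (0, 0)"
  shows "curve_norm F g \<noteq> 0"
  using degree_curve_norm(1)[of F "fst g" "snd g"] assms by (auto simp: curve_norm_def prod_eq_iff)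

lemma coord_mult_nonzero:
  assumes "odd (Polynomial.degree F)" "g \<noteq> (0, 0)" "h \<noteq> (0, 0)"
  shows "coord_mult F g h \<noteq> (0, 0)"
proof
  assume "coord_mult F g h = (0, 0)"
  hence "curve_norm F g * curve_norm F h = 0"
    by (simp add: curve_norm_mult[symmetric]) (simp add: curve_norm_def)
  thus False using curve_norm_nonzero[OF assms(1,2)] curve_norm_nonzero[OF assms(1,3)] by simp
qed

section \<open>Power series expansions at an affine point\<close>

lemma fps_X_dvd_iff: "fps_X dvd (f :: 'a::field fps) \<longleftrightarrow> fps_nth f 0 = 0"
  using subdegree_eq_0_iff[of f] by (cases "f = 0") (auto simp: fps_dvd_iff Suc_le_eq)

lemma fps_X_power_dvd_iff: "fps_X ^ n dvd (f :: 'a::field fps) \<longleftrightarrow> f = 0 \<or> n \<le> subdegree f"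
  by (cases "f = 0") (auto simp: fps_dvd_iff)

text \<open>The expansion of \<open>p(x)\<close> along \<open>x = x0 + Z\<close>.\<close>

definition expansion :: "'a::field \<Rightarrow> 'a fps \<Rightarrow> 'a poly \<Rightarrow> 'a fps" where
  "expansion x0 Z p = fps_of_poly (pcompose p [:x0, 1:]) oo Z"

text \<open>A formal parametrisation \<open>x = x0 + Z\<close>, \<open>y = Y\<close> of the curve
  near \<open>(x0, y0)\<close>. One locale serves both kinds of points: \<open>Z = fps_X\<close> is
  taken where \<open>y0 \<noteq> 0\<close>, and \<open>Y = fps_X\<close> at a branch point. By
  \<open>Z \<noteq> 0\<close> the abscissa is not constant, so no non-zero polynomial in
  \<open>x\<close> expands to 0.\<close>

locale local_param =
  fixes F :: "'a::field poly" and x0 y0 :: 'a and Z Y :: "'a fps"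
  assumes Z_0: "fps_nth Z 0 = 0" and Z_nonzero: "Z \<noteq> 0"
    and Y_0: "fps_nth Y 0 = y0" and Y_sq: "Y ^ 2 = expansion x0 Z F"
begin

abbreviation "\<phi> \<equiv> expansion x0 Z"

lemma expansion_0 [simp]: "\<phi> 0 = 0"
  by (simp add: expansion_def)

lemma expansion_const [simp]: "\<phi> [:c:] = fps_const c"
  by (simp add: expansion_def fps_of_poly_const)

lemma expansion_1 [simp]: "\<phi> 1 = 1"
  using expansion_const[of 1] by (simp add: one_pCons[symmetric])

lemma expansion_add: "\<phi> (p + q) = \<phi> p + \<phi> q"
  by (simp add: expansion_def pcompose_add fps_of_poly_add fps_compose_add_distrib)

lemma expansion_mult: "\<phi> (p * q) = \<phi> p * \<phi> q"
  by (simp add: expansion_def pcompose_mult fps_of_poly_mult fps_compose_mult_distrib Z_0)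

lemma expansion_minus: "\<phi> (- p) = - \<phi> p"
  using expansion_add[of p "- p"] by (simp add: eq_neg_iff_add_eq_0 add.commute)

lemma expansion_diff: "\<phi> (p - q) = \<phi> p - \<phi> q"
  using expansion_add[of p "- q"] by (simp add: expansion_minus)

lemma expansion_power: "\<phi> (p ^ n) = \<phi> p ^ n"
  by (induction n) (simp_all add: expansion_mult)

lemma expansion_linear: "\<phi> [:- x0, 1:] = Z"
  by (simp add: expansion_def pcompose_pCons fps_X_fps_compose_startby0 Z_0)

lemma expansion_nth_0: "fps_nth (\<phi> p) 0 = poly p x0"
  by (simp add: expansion_def fps_compose_nth poly_0_coeff_0[symmetric] poly_pcompose)

lemma expansion_decomp:
  assumes "p \<noteq> 0"
  shows "subdegree (\<phi> p) = Polynomial.order x0 p * subdegree Z" "\<phi> p \<noteq> 0"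
proof -
  obtain r where r: "p = [:- x0, 1:] ^ Polynomial.order x0 p * r" "\<not> [:- x0, 1:] dvd r"
    using order_decomp[OF assms] by blast
  have "\<phi> p = \<phi> ([:- x0, 1:] ^ Polynomial.order x0 p * r)" using r(1) by simp
  hence eq: "\<phi> p = Z ^ Polynomial.order x0 p * \<phi> r"
    by (simp only: expansion_mult expansion_power expansion_linear)
  have nz: "fps_nth (\<phi> r) 0 \<noteq> 0"
    using r(2) by (simp add: linear_dvd_iff expansion_nth_0)
  hence nz': "\<phi> r \<noteq> 0" by auto
  show "subdegree (\<phi> p) = Polynomial.order x0 p * subdegree Z"
    using nz' subdegree_eq_0[OF nz] Z_nonzero by (simp add: eq)
  show "\<phi> p \<noteq> 0" using nz' Z_nonzero by (simp add: eq)
qed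

lemma linear_power_dvd_if_expansion:
  assumes "p = 0 \<or> n * subdegree Z \<le> subdegree (\<phi> p)"
  shows "[:- x0, 1:] ^ n dvd p"
proof (cases "p = 0")
  case False
  have "subdegree Z > 0" using Z_0 Z_nonzero subdegree_eq_0_iff[of Z] by auto
  thus ?thesis using assms False expansion_decomp(1)[OF False] by (simp add: order_divides)
qed simp

definition ev :: "'a poly poly \<Rightarrow> 'a fps" where
  "ev b = poly (map_poly \<phi> b) Y"

lemma ev_0 [simp]: "ev 0 = 0" by (simp add: ev_def)

lemma ev_add: "ev (a + b) = ev a + ev b"
  by (simp add: ev_def map_poly_add_hom expansion_add)

lemma ev_mult: "ev (a * b) = ev a * ev b"
  by (simp add: ev_def map_poly_mult_hom expansion_add expansion_mult)

lemma ev_1 [simp]: "ev 1 = 1" by (simp add: ev_def)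

lemma ev_power: "ev (a ^ n) = ev a ^ n"
  by (induction n) (simp_all add: ev_mult)

lemma ev_pCons: "ev (pCons p b) = \<phi> p + Y * ev b"
  by (simp add: ev_def map_poly_pCons)

definition germ :: "'a coord_fun \<Rightarrow> 'a fps" where
  "germ g = \<phi> (fst g) + \<phi> (snd g) * Y"

lemma ev_bivariate: "ev (bivariate g) = germ g"
  by (simp add: bivariate_def ev_pCons germ_def mult.commute)

lemma germ_mult: "germ (coord_mult F g h) = germ g * germ h"
  by (simp add: germ_def coord_mult_def expansion_add expansion_mult Y_sq[symmetric]
      power2_eq_square algebra_simps)

lemma germ_nth_0: "fps_nth (germ g) 0 = poly (fst g) x0 + poly (snd g) x0 * y0"
  by (simp add: germ_def expansion_nth_0 Y_0)

text \<open>The germ divides the expansion of the norm, and the norm is a non-zero polynomial in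
  \<open>x\<close> alone.\<close>

lemma germ_nonzero:
  assumes "odd (Polynomial.degree F)" "g \<noteq> (0, 0)"
  shows "germ g \<noteq> 0"
proof
  assume "germ g = 0"
  moreover have "\<phi> (curve_norm F g) = germ g * (\<phi> (fst g) - \<phi> (snd g) * Y)"
    by (simp add: curve_norm_def germ_def expansion_diff expansion_mult expansion_power
        Y_sq[symmetric] power2_eq_square algebra_simps)
  ultimately show False
    using expansion_decomp(2)[OF curve_norm_nonzero[OF assms]] by simp
qed

text \<open>Substituting the parametrisation kills the curve equation and sends both generators of
  the maximal ideal to series without constant term; a product of \<open>n\<close> of these is
  divisible by \<open>fps_X ^ n\<close>.\<close>

lemma ideal_power_imp_dvd_germ:
  assumes "in_max_ideal_power F x0 y0 n g"
  shows "fps_X ^ n dvd germ g"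
proof -
  obtain c r where g: "bivariate g =
      (\<Sum>i\<le>n. c i * [:[:- x0, 1:]:] ^ i * [:[:- y0:], 1:] ^ (n - i)) + r * curve_eqn F"
    using assms unfolding in_max_ideal_power_def by blast
  have V: "ev [:[:- y0:], 1:] = Y - fps_const y0"
    by (simp add: ev_pCons fps_const_neg[symmetric] del: fps_const_neg)
  have U: "ev [:[:- x0, 1:]:] = Z"
    by (simp add: ev_pCons expansion_linear)
  have E: "ev (curve_eqn F) = 0"
    by (simp add: curve_eqn_def ev_pCons expansion_minus Y_sq[symmetric] power2_eq_square)
  have "germ g = (\<Sum>i\<le>n. ev (c i) * (Z ^ i * (Y - fps_const y0) ^ (n - i)))"
    unfolding ev_bivariate[symmetric] g
    by (simp only: sum_hom[of ev, OF ev_0 ev_add] ev_add ev_mult ev_power U V E) (simp add: mult.assoc)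
  also have "fps_X ^ n dvd \<dots>"
  proof (rule dvd_sum, rule dvd_mult)
    fix i assume "i \<in> {..n}"
    hence "fps_X ^ n = fps_X ^ i * (fps_X ^ (n - i) :: 'a fps)"
      by (simp add: power_add[symmetric])
    also have "\<dots> dvd Z ^ i * (Y - fps_const y0) ^ (n - i)"
      by (intro mult_dvd_mono dvd_power_same) (simp_all add: fps_X_dvd_iff Z_0 Y_0)
    finally show "fps_X ^ n dvd Z ^ i * (Y - fps_const y0) ^ (n - i)" .
  qed
  finally show ?thesis .
qed

end

text \<open>The second condition means squarefreeness once the field is algebraically closed, which
  is where the predicate is applied to the Jacobian.\<close>

definition smooth_odd :: "'a::field poly \<Rightarrow> bool" where
  "smooth_odd F \<longleftrightarrow> odd (Polynomial.degree F) \<and> (\<forall>x. poly F x = 0 \<longrightarrow> poly (pderiv F) x \<noteq> 0)"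

context local_param
begin

text \<open>One implication between ideal powers and divisibility of germs holds for every
  parametrisation. The converse depends on the kind of point and is therefore a hypothesis; both
  together turn the set under \<open>GREATEST\<close> into an initial segment.\<close>

lemma ord_at_eq_subdegree_germ:
  assumes "odd (Polynomial.degree F)" "g \<noteq> (0, 0)"
    and "\<And>n. fps_X ^ n dvd germ g \<Longrightarrow> in_max_ideal_power F x0 y0 n g"
  shows "ord_at F (Affine x0 y0) g = int (subdegree (germ g))"
proof -
  have iff: "in_max_ideal_power F x0 y0 n g \<longleftrightarrow> n \<le> subdegree (germ g)" for n
    using assms(3)[of n] ideal_power_imp_dvd_germ[of n g] germ_nonzero[OF assms(1,2)]
    by (auto simp: fps_X_power_dvd_iff)
  have "(GREATEST n. n \<le> subdegree (germ g)) = subdegree (germ g)"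
    by (rule Greatest_equality) auto
  thus ?thesis by (simp add: iff)
qed

end

section \<open>Local parameters at ordinary points and at branch points\<close>

abbreviation (input) U_gen :: "'a::field \<Rightarrow> 'a poly poly" where "U_gen x0 \<equiv> [:[:- x0, 1:]:]"
abbreviation (input) V_gen :: "'a::field \<Rightarrow> 'a poly poly" where "V_gen y0 \<equiv> [:[:- y0:], 1:]"

lemma linear_power_dvd_in_ideal_power:
  assumes "[:- x0, 1:] ^ n dvd p"
  shows "[:p:] \<in> ideal_power (U_gen x0) V E n"
proof -
  obtain r where "p = [:- x0, 1:] ^ n * r" using assms by (rule dvdE)
  hence "[:p:] = [:r:] * (U_gen x0 ^ n * V ^ (n - n))"
    by (simp add: poly_const_pow mult.commute)
  thus ?thesis by (simp only: ideal_power_mult_left ideal_power_generator order_refl)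
qed

lemma const_poly_decomp:
  obtains r where "[:p:] = [:[:poly p x0:]:] + U_gen x0 * [:r:]"
proof -
  have "[:- x0, 1:] dvd p - [:poly p x0:]" by (simp add: linear_dvd_iff)
  then obtain r where "p - [:poly p x0:] = [:- x0, 1:] * r" by (rule dvdE)
  hence "[:p:] = [:[:poly p x0:]:] + U_gen x0 * [:r:]"
    by (simp add: algebra_simps)
  thus ?thesis by (rule that)
qed

text \<open>Here \<open>x - x0\<close> is a local parameter. To get back from germs to ideal powers,
  \<open>y\<close> is replaced by a polynomial \<open>S\<close> that agrees with it to order
  \<open>n\<close>: then \<open>p + q S\<close> is divisible by \<open>(x - x0)^n\<close>, and
  \<open>y - S\<close> lies in the \<open>n\<close>-th power of the maximal ideal.\<close>

lemma local_param_regular: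
  fixes F :: "'a::field_char_0 poly"
  assumes F: "odd (Polynomial.degree F)" and P: "y0 ^ 2 = poly F x0" "y0 \<noteq> 0"
  shows "\<exists>Y. local_param F x0 y0 fps_X Y \<and>
    (\<forall>g. g \<noteq> (0, 0) \<longrightarrow> ord_at F (Affine x0 y0) g = int (subdegree (local_param.germ x0 fps_X Y g)))"
proof -
  define a where "a = expansion x0 fps_X F"
  have a0: "fps_nth a 0 = y0 ^ 2"
    by (simp add: a_def expansion_def fps_compose_nth poly_0_coeff_0[symmetric] poly_pcompose P)
  \<comment> \<open>The first argument of \<open>fps_radical\<close> selects the square root of the
    constant coefficient, so the branch through \<open>(x0, y0)\<close> is the one with value
    \<open>y0\<close>.\<close>
  define Y where "Y = fps_radical (\<lambda>_ _. y0) (Suc 1) a"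
  have "Y ^ Suc 1 = a"
    unfolding Y_def using power_radical[of a "\<lambda>_ _. y0" 1] a0 P(2) by (simp add: power2_eq_square)
  hence Ysq: "Y ^ 2 = a" by (simp add: power2_eq_square)
  have "fps_nth Y 0 = y0" by (simp add: Y_def)
  then interpret local_param F x0 y0 fps_X Y
    by unfold_locales (simp_all add: Ysq a_def)
  have "in_max_ideal_power F x0 y0 n g" if dvd: "fps_X ^ n dvd germ g" for n g
  proof -
    obtain S where S: "poly S x0 = y0" "[:-x0, 1:] ^ n dvd F - S ^ 2"
      using sqrt_poly_mod_exists[OF P, of n] by blast
    obtain R where R: "F - S ^ 2 = [:-x0, 1:] ^ n * R" using S(2) by (rule dvdE)
    have "(Y + \<phi> S) * (Y - \<phi> S) = fps_X ^ n * \<phi> R"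
      using arg_cong[OF R, of \<phi>]
      by (simp add: expansion_diff expansion_mult expansion_power expansion_linear Y_sq[symmetric]
          power2_eq_square algebra_simps)
    hence "fps_X ^ n dvd (Y + \<phi> S) * (Y - \<phi> S)" by simp
    moreover have u: "fps_nth (Y + \<phi> S) 0 \<noteq> 0"
      using P(2) S(1) by (simp add: Y_0 expansion_nth_0)
    hence "Y + \<phi> S \<noteq> 0" by (metis fps_zero_nth)
    moreover have "subdegree (Y + \<phi> S) = 0" using u by (rule subdegree_eq_0)
    ultimately have "fps_X ^ n dvd Y - \<phi> S"
      by (cases "Y - \<phi> S = 0") (simp_all add: fps_X_power_dvd_iff subdegree_mult)
    hence "fps_X ^ n dvd germ g - \<phi> (snd g) * (Y - \<phi> S)"
      using dvd by (simp only: dvd_diff dvd_mult)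
    hence "fps_X ^ n dvd \<phi> (fst g + snd g * S)"
      by (simp add: germ_def expansion_add expansion_mult algebra_simps)
    hence "[:- x0, 1:] ^ n dvd fst g + snd g * S"
      using expansion_decomp(2)[of "fst g + snd g * S"]
      by (intro linear_power_dvd_if_expansion) (auto simp: fps_X_power_dvd_iff)
    hence 1: "[:fst g + snd g * S:] \<in> ideal_power (U_gen x0) (V_gen y0) (curve_eqn F) n"
      by (rule linear_power_dvd_in_ideal_power)
    \<comment> \<open>On the curve \<open>(y - S) (y + S) = F - S^2\<close>, which is divisible by
      \<open>(x - x0)^n\<close>.\<close>
    have "[:F - S ^ 2:] + 1 * curve_eqn F \<in> ideal_power (U_gen x0) (V_gen y0) (curve_eqn F) n"
      by (intro ideal_power_add ideal_power_relation linear_power_dvd_in_ideal_power S)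
    moreover have "[:F - S ^ 2:] + 1 * curve_eqn F = [:- S, 1:] * [:S, 1:]"
      by (simp add: curve_eqn_def power2_eq_square)
    ultimately have "[:- S, 1:] * [:S, 1:] \<in> ideal_power (U_gen x0) (V_gen y0) (curve_eqn F) n"
      by simp
    moreover obtain r where r: "[:S:] = [:[:poly S x0:]:] + U_gen x0 * [:r:]"
      by (rule const_poly_decomp)
    \<comment> \<open>The factor \<open>y + S\<close> has the value \<open>2 * y0\<close> at the
      point, so it can be cancelled as a unit.\<close>
    hence "[:S, 1:] = [:[:2 * y0:]:] + U_gen x0 * [:r:] + V_gen y0 * 1"
      using S(1) by simp
    moreover have "[:[:2 * y0:]:] * [:[:1 / (2 * y0):]:] = 1"
      using P(2) by (simp add: one_pCons)
    ultimately have "[:- S, 1:] \<in> ideal_power (U_gen x0) (V_gen y0) (curve_eqn F) n"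
      by (rule ideal_power_cancel_unit)
    hence "[:fst g + snd g * S:] + [:snd g:] * [:- S, 1:]
        \<in> ideal_power (U_gen x0) (V_gen y0) (curve_eqn F) n"
      by (intro ideal_power_add 1 ideal_power_mult_left)
    thus ?thesis by (simp add: in_max_ideal_power_iff bivariate_def)
  qed
  thus ?thesis
    using local_param_axioms ord_at_eq_subdegree_germ[OF F] by blast
qed

text \<open>At a branch point \<open>y\<close> is a local parameter and \<open>x - x0\<close> has
  order 2. Hence \<open>(x - x0)^k\<close> lies in the power \<open>2 k\<close> of the maximal
  ideal, and \<open>y (x - x0)^k\<close> in the power \<open>2 k + 1\<close>.\<close>

lemma local_param_branch:
  fixes F :: "'a::field_char_0 poly"
  assumes F: "odd (Polynomial.degree F)" and P: "poly F x0 = 0" "poly (pderiv F) x0 \<noteq> 0"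
  shows "\<exists>Z. local_param F x0 0 Z fps_X \<and> subdegree Z = 2 \<and>
    (\<forall>g. g \<noteq> (0, 0) \<longrightarrow> ord_at F (Affine x0 0) g = int (subdegree (local_param.germ x0 Z fps_X g)))"
proof -
  define f where "f = fps_of_poly (pcompose F [:x0, 1:])"
  have f0: "fps_nth f 0 = 0"
    by (simp add: f_def poly_0_coeff_0[symmetric] poly_pcompose P)
  have "fps_nth f 1 = fps_nth (fps_deriv f) 0" by simp
  also have "\<dots> = poly (pderiv F) x0"
    by (simp add: f_def fps_of_poly_pderiv[symmetric] poly_0_coeff_0[symmetric] pderiv_pcompose
        poly_pcompose del: fps_deriv_nth) (simp add: pderiv_pCons)
  finally have f1: "fps_nth f 1 \<noteq> 0" using P by simp
  \<comment> \<open>This is the solution of \<open>F(x0 + Z) = fps_X^2\<close>, by inverting the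
    series of \<open>F\<close> around the simple root \<open>x0\<close>.\<close>
  define Z where "Z = fps_inv f oo fps_X ^ 2"
  have inv0: "fps_nth (fps_inv f) 0 = 0" by (simp add: fps_inv_def)
  have Z0: "fps_nth Z 0 = 0" by (simp add: Z_def fps_compose_nth inv0)
  have "f oo Z = (f oo fps_inv f) oo fps_X ^ 2"
    unfolding Z_def by (rule fps_compose_assoc) (simp_all add: inv0)
  also have "\<dots> = fps_X ^ 2"
    by (simp add: fps_inv_right f0 f1[simplified] fps_X_fps_compose_startby0)
  finally have sq: "fps_X ^ 2 = f oo Z" ..
  have Znz: "Z \<noteq> 0"
  proof
    assume "Z = 0"
    hence "f oo Z = 0" by (simp add: f0)
    thus False using sq by (metis fps_X_neq_zero power_not_zero)
  qed
  interpret local_param F x0 0 Z fps_X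
    by unfold_locales (simp_all add: Z0 Znz sq f_def expansion_def)
  obtain F1 where F1: "F = [:- x0, 1:] * F1"
    using P(1) by (auto simp: linear_dvd_iff[symmetric] elim: dvdE)
  have F1x: "poly F1 x0 \<noteq> 0"
    using P(2) unfolding F1 pderiv_mult by (simp add: pderiv_pCons)
  have "fps_X ^ 2 = Z * \<phi> F1"
    using Y_sq by (simp only: F1 expansion_mult expansion_linear)
  hence "2 = subdegree (Z * \<phi> F1)" by (metis fps_X_power_subdegree)
  moreover have "subdegree (\<phi> F1) = 0" "\<phi> F1 \<noteq> 0"
    using F1x expansion_nth_0[of F1] by auto
  ultimately have Z2: "subdegree Z = 2" using Znz by simp
  let ?M = "ideal_power (U_gen x0) (V_gen 0) (curve_eqn F)"
  \<comment> \<open>On the curve \<open>y^2 = (x - x0) F1\<close>, and \<open>F1\<close> is a unit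
    at the point because the root is simple. So \<open>x - x0\<close> belongs to the square of the
    maximal ideal.\<close>
  have lin: "U_gen x0 \<in> ?M 2"
  proof -
    have "V_gen 0 * V_gen 0 \<in> ?M (1 + 1)"
      using ideal_power_1I[of "U_gen x0" 0 "V_gen 0" 1] by (intro ideal_power_mult) simp_all
    hence "V_gen 0 * V_gen 0 - 1 * curve_eqn F \<in> ?M 2"
      by (intro ideal_power_diff ideal_power_relation) (simp add: numeral_2_eq_2)
    moreover have "V_gen 0 * V_gen 0 - 1 * curve_eqn F = U_gen x0 * [:F1:]"
      by (simp add: curve_eqn_def F1)
    ultimately have "U_gen x0 * [:F1:] \<in> ?M 2" by simp
    moreover obtain r where r: "[:F1:] = [:[:poly F1 x0:]:] + U_gen x0 * [:r:]"
      by (rule const_poly_decomp)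
    hence "[:F1:] = [:[:poly F1 x0:]:] + U_gen x0 * [:r:] + V_gen 0 * 0" by simp
    moreover have "[:[:poly F1 x0:]:] * [:[:1 / poly F1 x0:]:] = 1"
      using F1x by (simp add: one_pCons)
    ultimately show ?thesis by (rule ideal_power_cancel_unit)
  qed
  have pow: "U_gen x0 ^ k \<in> ?M (2 * k)" for k
  proof (induction k)
    case (Suc k)
    have "U_gen x0 * U_gen x0 ^ k \<in> ?M (2 + 2 * k)"
      by (intro ideal_power_mult lin Suc)
    thus ?case by (simp only: power_Suc mult_Suc_right)
  qed simp
  have "in_max_ideal_power F x0 0 n g" if dvd: "fps_X ^ n dvd germ g" and g: "g \<noteq> (0, 0)" for n g
  proof -
    obtain p q where pq: "g = (p, q)" by (cases g)
    have le: "n \<le> subdegree (\<phi> p + \<phi> q * fps_X)"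
      using dvd germ_nonzero[OF F g] by (simp add: fps_X_power_dvd_iff germ_def pq)
    have sp: "subdegree (\<phi> p) = 2 * Polynomial.order x0 p" if "p \<noteq> 0"
      using expansion_decomp(1)[OF that] Z2 by simp
    have sq: "subdegree (\<phi> q * fps_X) = 2 * Polynomial.order x0 q + 1" "\<phi> q * fps_X \<noteq> 0" if "q \<noteq> 0"
      using expansion_decomp[OF that] Z2 by simp_all
    \<comment> \<open>The orders of \<open>p\<close> and \<open>q y\<close> have different parity, so they cannot cancel.\<close>
    have both: "n \<le> subdegree (\<phi> p) \<and> n \<le> subdegree (\<phi> q * fps_X)" if "p \<noteq> 0" "q \<noteq> 0"
    proof -
      have "subdegree (\<phi> p) \<noteq> subdegree (\<phi> q * fps_X)"
        unfolding sp[OF that(1)] sq(1)[OF that(2)] by presburger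
      thus ?thesis
        using le subdegree_add_eq1[of "\<phi> p" "\<phi> q * fps_X"] subdegree_add_eq2[of "\<phi> q * fps_X" "\<phi> p"]
          expansion_decomp(2)[OF that(1)] sq(2)[OF that(2)] by linarith
    qed
    have "[:p:] \<in> ?M n"
    proof (cases "p = 0")
      case True
      thus ?thesis using ideal_power_relation[of 0] by simp
    next
      case False
      have "n \<le> 2 * Polynomial.order x0 p"
        using both le sp False by (cases "q = 0") auto
      moreover obtain r where "p = [:- x0, 1:] ^ Polynomial.order x0 p * r"
        using order_decomp[OF False] by blast
      hence "[:p:] = [:r:] * U_gen x0 ^ Polynomial.order x0 p"
        by (simp add: poly_const_pow mult.commute)
      ultimately show ?thesis
        using ideal_power_antimono[OF ideal_power_mult_left[OF pow]] by metis
    qed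
    moreover have "[:q:] * V_gen 0 \<in> ?M n"
    proof (cases "q = 0")
      case True
      thus ?thesis using ideal_power_relation[of 0] by simp
    next
      case False
      have n: "n \<le> 2 * Polynomial.order x0 q + 1"
        using both le sq False by (cases "p = 0") auto
      obtain r where "q = [:- x0, 1:] ^ Polynomial.order x0 q * r"
        using order_decomp[OF False] by blast
      hence q: "[:q:] = [:r:] * U_gen x0 ^ Polynomial.order x0 q"
        by (simp add: poly_const_pow mult.commute)
      have "V_gen 0 \<in> ?M 1"
        using ideal_power_1I[of "U_gen x0" 0 "V_gen 0" 1] by simp
      hence "[:q:] * V_gen 0 \<in> ?M (2 * Polynomial.order x0 q + 1)"
        unfolding q by (intro ideal_power_mult ideal_power_mult_left pow)
      thus ?thesis using n by (rule ideal_power_antimono)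
    qed
    ultimately have "[:p:] + [:q:] * V_gen 0 \<in> ?M n" by (rule ideal_power_add)
    thus ?thesis by (simp add: in_max_ideal_power_iff bivariate_def pq)
  qed
  thus ?thesis
    using local_param_axioms ord_at_eq_subdegree_germ[OF F] Z2 by blast
qed

lemma local_param_exists:
  fixes F :: "'a::field_char_0 poly"
  assumes "smooth_odd F" "y0 ^ 2 = poly F x0"
  obtains Z Y where "local_param F x0 y0 Z Y" "y0 \<noteq> 0 \<Longrightarrow> subdegree Z = 1"
    "y0 = 0 \<Longrightarrow> subdegree Z = 2 \<and> Y = fps_X"
    "\<And>g. g \<noteq> (0, 0) \<Longrightarrow> ord_at F (Affine x0 y0) g = int (subdegree (local_param.germ x0 Z Y g))"
proof (cases "y0 = 0")
  case False
  thus ?thesis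
    using local_param_regular[of F y0 x0] assms that unfolding smooth_odd_def
    by (metis subdegree_fps_X)
next
  case True
  thus ?thesis
    using local_param_branch[of F x0] assms that unfolding smooth_odd_def
    by (metis power_zero_numeral)
qed

text \<open>At affine points germs multiply, and subdegrees of power series over a field add. At
  infinity norms multiply and their degrees add.\<close>

lemma ord_at_mult:
  fixes F :: "'a::field_char_0 poly"
  assumes F: "smooth_odd F" and P: "P \<in> curve_points F" and g: "g \<noteq> (0, 0)" and h: "h \<noteq> (0, 0)"
  shows "ord_at F P (coord_mult F g h) = ord_at F P g + ord_at F P h"
proof (cases P)
  case Infinity
  have "odd (Polynomial.degree F)" using F by (simp add: smooth_odd_def)
  note nz = curve_norm_nonzero[OF this g] curve_norm_nonzero[OF this h]
  show ?thesis
    using nz by (simp add: Infinity curve_norm_def[symmetric] curve_norm_mult degree_mult_eq)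
next
  case (Affine x y)
  have odd: "odd (Polynomial.degree F)" using F by (simp add: smooth_odd_def)
  have "y ^ 2 = poly F x" using P Affine by (auto simp: curve_points_def)
  from local_param_exists[OF F this] obtain Z Y where lp: "local_param F x y Z Y"
    and ord: "\<And>g. g \<noteq> (0, 0) \<Longrightarrow>
      ord_at F (Affine x y) g = int (subdegree (local_param.germ x Z Y g))" by metis
  interpret local_param F x y Z Y by (rule lp)
  show ?thesis
    using ord[OF g] ord[OF h] ord[OF coord_mult_nonzero[OF odd g h]]
      germ_nonzero[OF odd g] germ_nonzero[OF odd h]
    by (simp add: Affine germ_mult)
qed

lemma ord_at_affine_eq_0_iff:
  fixes F :: "'a::field_char_0 poly"
  assumes F: "smooth_odd F" and P: "y ^ 2 = poly F x" and g: "g \<noteq> (0, 0)"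
  shows "ord_at F (Affine x y) g = 0 \<longleftrightarrow> poly (fst g) x + poly (snd g) x * y \<noteq> 0"
proof -
  have odd: "odd (Polynomial.degree F)" using F by (simp add: smooth_odd_def)
  from local_param_exists[OF F P] obtain Z Y where lp: "local_param F x y Z Y"
    and ord: "\<And>g. g \<noteq> (0, 0) \<Longrightarrow>
      ord_at F (Affine x y) g = int (subdegree (local_param.germ x Z Y g))" by metis
  interpret local_param F x y Z Y by (rule lp)
  show ?thesis
    unfolding ord[OF g] using germ_nonzero[OF odd g] by (simp add: subdegree_eq_0_iff germ_nth_0)
qed

text \<open>If \<open>y \<noteq> 0\<close>, vanishing at both \<open>(x, y)\<close> and
  \<open>(x, - y)\<close> separates the two components of \<open>g\<close>. If \<open>y = 0\<close>,
  the order of \<open>g\<close> is at least 2, and the coefficients 0 and 1 of the germ do the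
  same.\<close>

lemma linear_dvd_if_ord_at_ge:
  fixes F :: "'a::field_char_0 poly"
  assumes F: "smooth_odd F" and P: "y ^ 2 = poly F x" and g: "g \<noteq> (0, 0)"
    and le: "\<And>y. y ^ 2 = poly F x \<Longrightarrow>
      ord_at F (Affine x y) ([:- x, 1:], 0) \<le> ord_at F (Affine x y) g"
  shows "[:- x, 1:] dvd fst g \<and> [:- x, 1:] dvd snd g"
proof -
  have van: "poly (fst g) x + poly (snd g) x * y = 0" if "y ^ 2 = poly F x" for y
  proof -
    have "ord_at F (Affine x y) ([:- x, 1:], 0) \<noteq> 0"
      using ord_at_affine_eq_0_iff[OF F that, of "([:- x, 1:], 0)"] by simp
    hence "ord_at F (Affine x y) g \<noteq> 0" using le[OF that] by simp
    thus ?thesis using ord_at_affine_eq_0_iff[OF F that g] by simp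
  qed
  show ?thesis
  proof (cases "y = 0")
    case False
    have "poly (fst g) x + poly (snd g) x * y = 0" "poly (fst g) x - poly (snd g) x * y = 0"
      using van[OF P] van[of "- y"] P by simp_all
    hence "2 * poly (fst g) x = 0" "2 * y * poly (snd g) x = 0"
      by (simp_all add: algebra_simps)
    thus ?thesis using False by (simp add: linear_dvd_iff)
  next
    case True
    from local_param_exists[OF F P] True obtain Z where lp: "local_param F x 0 Z fps_X"
      and Z: "subdegree Z = 2" and ord: "\<And>g. g \<noteq> (0, 0) \<Longrightarrow>
        ord_at F (Affine x 0) g = int (subdegree (local_param.germ x Z fps_X g))" by metis
    interpret local_param F x 0 Z fps_X by (rule lp)
    have "germ ([:- x, 1:], 0) = Z" by (simp add: germ_def expansion_linear)
    hence "2 \<le> subdegree (germ g)"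
      using le[OF P] ord[of "([:- x, 1:], 0)"] ord[OF g] Z True by simp
    hence "fps_nth (germ g) 1 = 0" by (intro nth_less_subdegree_zero) simp
    hence 1: "fps_nth (\<phi> (fst g)) 1 + poly (snd g) x = 0"
      by (simp add: germ_def expansion_nth_0)
    have p: "poly (fst g) x = 0" using van[OF P] True by simp
    \<comment> \<open>The expansion of a polynomial in \<open>x\<close> has even order, since
      \<open>Z\<close> has order 2. Vanishing at 0 thus forces order at least 2.\<close>
    have "fps_nth (\<phi> (fst g)) 1 = 0"
    proof (cases "fst g = 0")
      case False
      have "0 < Polynomial.order x (fst g)" using p False by (simp add: order_root)
      hence "1 < subdegree (\<phi> (fst g))"
        using expansion_decomp(1)[OF False] Z by simp
      thus ?thesis by blast
    qed simp
    thus ?thesis using 1 p by (simp add: linear_dvd_iff)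
  qed
qed

section \<open>The Jacobian as a group\<close>

lemma comm_group_subgroup:
  assumes "comm_group G" "subgroup H G"
  shows "comm_group (G\<lparr>carrier := H\<rparr>)"
proof -
  interpret comm_group G by (rule assms)
  interpret H: group "G\<lparr>carrier := H\<rparr>"
    by (rule subgroup.subgroup_is_group[OF assms(2) is_group])
  show ?thesis
    by (rule H.group_comm_groupI) (use subgroup.mem_carrier[OF assms(2)] m_comm in auto)
qed

lemma abelian_rank_pos:
  fixes G (structure)
  assumes "comm_group G" "\<xi> \<in> carrier G" "\<And>n::nat. n > 0 \<Longrightarrow> \<xi> [^]\<^bsub>G\<^esub> n \<noteq> \<one>\<^bsub>G\<^esub>"
  shows "abelian_rank G > 0"
proof -
  interpret comm_group G by (rule assms)
  have "k = 0" if "\<xi> [^] k = \<one>" for k :: int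
  proof (rule ccontr)
    assume "k \<noteq> 0"
    have "\<xi> [^] \<bar>k\<bar> = \<one>"
      using that assms(2) by (cases "k \<ge> 0") (simp_all add: int_pow_neg)
    hence "\<xi> [^] nat \<bar>k\<bar> = \<one>" by (metis abs_ge_zero int_nat_eq int_pow_int)
    thus False using assms(3)[of "nat \<bar>k\<bar>"] \<open>k \<noteq> 0\<close> by simp
  qed
  hence "int_independent G {\<xi>}"
    using assms(2) by (simp add: int_independent_def)
  hence "enat (card {\<xi>}) \<le> abelian_rank G"
    unfolding abelian_rank_def by (intro SUP_upper) simp
  thus ?thesis
    using less_le_trans[of 0 "enat (card {\<xi>})" "abelian_rank G"] by (simp add: zero_enat_def)
qed

section \<open>Divisors of degree 0 and principal divisors\<close>

lemma divisor_degree_superset: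
  assumes "finite A" "Poly_Mapping.keys \<Delta> \<subseteq> A"
  shows "divisor_degree \<Delta> = (\<Sum>P\<in>A. Poly_Mapping.lookup \<Delta> P)"
  unfolding divisor_degree_def using assms
  by (intro sum.mono_neutral_left) (auto simp: in_keys_iff)

lemma divisor_degree_add: "divisor_degree (a + b) = divisor_degree a + divisor_degree b"
proof -
  let ?A = "Poly_Mapping.keys a \<union> Poly_Mapping.keys b"
  have "Poly_Mapping.keys (a + b) \<subseteq> ?A" by (rule keys_add)
  thus ?thesis
    by (simp add: divisor_degree_superset[of ?A] lookup_add sum.distrib)
qed

lemma divisor_degree_0 [simp]: "divisor_degree 0 = 0"
  by (simp add: divisor_degree_def)

lemma divisor_degree_minus: "divisor_degree (- a) = - divisor_degree a"
  using divisor_degree_add[of a "- a"] by simp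

lemma carrier_Div0:
  "carrier (Div0 F) = {\<Delta>. Poly_Mapping.keys \<Delta> \<subseteq> curve_points F \<and> divisor_degree \<Delta> = 0}"
  by (simp add: Div0_def)

lemma one_Div0 [simp]: "\<one>\<^bsub>Div0 F\<^esub> = 0"
  by (simp add: Div0_def)

lemma mult_Div0 [simp]: "a \<otimes>\<^bsub>Div0 F\<^esub> b = a + b"
  by (simp add: Div0_def)

lemma subgroup_Div0:
  "subgroup (carrier (Div0 F)) (free_Abelian_group (curve_points F))"
proof -
  interpret group "free_Abelian_group (curve_points F)" by simp
  show ?thesis
  proof (rule subgroupI)
    show "carrier (Div0 F) \<noteq> {}"
      by (auto simp: carrier_Div0 intro: exI[of _ 0])
    show "a \<otimes>\<^bsub>free_Abelian_group (curve_points F)\<^esub> b \<in> carrier (Div0 F)"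
      if "a \<in> carrier (Div0 F)" "b \<in> carrier (Div0 F)" for a b
      using that keys_add[of a b] by (auto simp: carrier_Div0 divisor_degree_add)
  qed (auto simp: carrier_Div0 divisor_degree_minus)
qed

lemma comm_group_Div0: "comm_group (Div0 F)"
proof -
  have "Div0 F = (free_Abelian_group (curve_points F))\<lparr>carrier := carrier (Div0 F)\<rparr>"
    by (simp add: Div0_def)
  thus ?thesis
    using comm_group_subgroup[OF abelian_free_Abelian_group subgroup_Div0] by metis
qed

lemma inv_Div0:
  assumes "a \<in> carrier (Div0 F)"
  shows "inv\<^bsub>Div0 F\<^esub> a = - a"
proof -
  interpret comm_group "Div0 F" by (rule comm_group_Div0)
  show ?thesis
    by (rule inv_equality) (use assms in \<open>auto simp: carrier_Div0 divisor_degree_minus\<close>)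
qed

lemma pow_Div0:
  assumes "a \<in> carrier (Div0 F)"
  shows "a [^]\<^bsub>Div0 F\<^esub> (n::nat) = frag_cmul (int n) a"
proof -
  interpret comm_group "Div0 F" by (rule comm_group_Div0)
  show ?thesis
    by (induction n) (simp_all add: frag_cmul_distrib algebra_simps)
qed

text \<open>Sums correspond to products of numerators and of denominators; smoothness enters through
  the additivity of orders.\<close>

lemma subgroup_principal_divisors:
  fixes F :: "'a::field_char_0 poly"
  assumes F: "smooth_odd F"
  shows "subgroup (principal_divisors F) (Div0 F)"
proof -
  interpret comm_group "Div0 F" by (rule comm_group_Div0)
  show ?thesis
  proof (rule subgroupI)
    show "principal_divisors F \<subseteq> carrier (Div0 F)"
      by (auto simp: principal_divisors_def)
    have "\<exists>g h. g \<noteq> (0, 0) \<and> h \<noteq> (0, 0) \<and>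
        (\<forall>P\<in>curve_points F. Poly_Mapping.lookup 0 P = ord_at F P g - ord_at F P h)"
      by (intro exI[of _ "(1, 0)"]) simp
    hence "0 \<in> principal_divisors F"
      by (simp add: principal_divisors_def carrier_Div0)
    thus "principal_divisors F \<noteq> {}" by blast
  next
    fix a assume "a \<in> principal_divisors F"
    then obtain g h where a: "a \<in> carrier (Div0 F)" "g \<noteq> (0, 0)" "h \<noteq> (0, 0)"
      "\<And>P. P \<in> curve_points F \<Longrightarrow> Poly_Mapping.lookup a P = ord_at F P g - ord_at F P h"
      unfolding principal_divisors_def by blast
    have "- a \<in> carrier (Div0 F)" using a(1) by (auto simp: carrier_Div0 divisor_degree_minus)
    moreover have "\<forall>P\<in>curve_points F. Poly_Mapping.lookup (- a) P = ord_at F P h - ord_at F P g"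
      using a(4) by simp
    ultimately show "inv\<^bsub>Div0 F\<^esub> a \<in> principal_divisors F"
      unfolding inv_Div0[OF a(1)] principal_divisors_def using a(2,3) by blast
  next
    fix a b assume "a \<in> principal_divisors F" "b \<in> principal_divisors F"
    then obtain g h g' h' where a: "a \<in> carrier (Div0 F)" "g \<noteq> (0, 0)" "h \<noteq> (0, 0)"
        "\<And>P. P \<in> curve_points F \<Longrightarrow> Poly_Mapping.lookup a P = ord_at F P g - ord_at F P h"
      and b: "b \<in> carrier (Div0 F)" "g' \<noteq> (0, 0)" "h' \<noteq> (0, 0)"
        "\<And>P. P \<in> curve_points F \<Longrightarrow> Poly_Mapping.lookup b P = ord_at F P g' - ord_at F P h'"
      unfolding principal_divisors_def by blast
    have odd: "odd (Polynomial.degree F)" using F by (simp add: smooth_odd_def)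
    have "a + b \<in> carrier (Div0 F)" using m_closed[OF a(1) b(1)] by simp
    moreover have "\<forall>P\<in>curve_points F. Poly_Mapping.lookup (a + b) P =
        ord_at F P (coord_mult F g g') - ord_at F P (coord_mult F h h')"
      using a b by (simp add: lookup_add ord_at_mult[OF F])
    ultimately show "a \<otimes>\<^bsub>Div0 F\<^esub> b \<in> principal_divisors F"
      unfolding principal_divisors_def
      using coord_mult_nonzero[OF odd a(2) b(2)] coord_mult_nonzero[OF odd a(3) b(3)]
      by (simp only: mult_Div0) blast
  qed
qed

section \<open>Field automorphisms acting on points, functions and divisors\<close>

locale curve_automorphism =
  fixes \<sigma> :: "'a::field \<Rightarrow> 'a" and F :: "'a poly"
  assumes bij: "bij \<sigma>" and hom_add: "\<And>x y. \<sigma> (x + y) = \<sigma> x + \<sigma> y"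
    and hom_mult: "\<And>x y. \<sigma> (x * y) = \<sigma> x * \<sigma> y" and F_fixed: "map_poly \<sigma> F = F"
begin

abbreviation \<tau> :: "'a \<Rightarrow> 'a" where "\<tau> \<equiv> inv_into UNIV \<sigma>"

lemma zero [simp]: "\<sigma> 0 = 0"
  using hom_add[of 0 0] by (metis add.right_neutral add_cancel_right_right)

lemma eq_0_iff [simp]: "\<sigma> x = 0 \<longleftrightarrow> x = 0"
  using bij zero by (metis bij_pointE)

lemma one [simp]: "\<sigma> 1 = 1"
  using hom_mult[of 1 1] by simp

lemma minus: "\<sigma> (- x) = - \<sigma> x"
  using hom_add[of x "- x"] by (simp add: eq_neg_iff_add_eq_0 add.commute)

lemma power: "\<sigma> (x ^ n) = \<sigma> x ^ n"
  by (induction n) (simp_all add: hom_mult)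

text \<open>Since the inverse is again an instance of the locale, every implication proved for
  \<sigma> can be reversed, and inclusions of images become equalities.\<close>

lemma inverse_automorphism: "curve_automorphism \<tau> F"
proof
  have s: "\<sigma> (\<tau> x) = x" for x using bij by (simp add: bij_is_surj surj_f_inv_f)
  have i: "\<tau> (\<sigma> x) = x" for x using bij by (simp add: bij_is_inj)
  show "bij \<tau>" using bij by (rule bij_imp_bij_inv)
  show "\<tau> (x + y) = \<tau> x + \<tau> y" for x y
    by (metis s i hom_add)
  show "\<tau> (x * y) = \<tau> x * \<tau> y" for x y
    by (metis s i hom_mult)
  have "\<tau> 0 = 0" by (metis i zero)
  hence "map_poly \<tau> (map_poly \<sigma> F) = F"
    by (simp add: map_poly_map_poly o_def i)
  thus "map_poly \<tau> F = F" by (simp add: F_fixed)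
qed

lemmas map_add = map_poly_add_hom[of \<sigma>, OF zero hom_add]
lemmas map_mult = map_poly_mult_hom[of \<sigma>, OF zero hom_add hom_mult]

lemma map_eq_0_iff [simp]: "map_poly \<sigma> p = 0 \<longleftrightarrow> p = 0"
  by (simp add: map_poly_eq_0_iff)

lemma map_minus: "map_poly \<sigma> (- p) = - map_poly \<sigma> p"
  by (rule poly_eqI) (simp add: coeff_map_poly minus)

lemma map_diff: "map_poly \<sigma> (p - q) = map_poly \<sigma> p - map_poly \<sigma> q"
  using map_add[of p "- q"] by (simp add: map_minus)

lemma map_power: "map_poly \<sigma> (p ^ n) = map_poly \<sigma> p ^ n"
  by (induction n) (simp_all add: map_mult)

definition map_coord :: "'a coord_fun \<Rightarrow> 'a coord_fun" where
  "map_coord g = (map_poly \<sigma> (fst g), map_poly \<sigma> (snd g))"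

lemma map_coord_nonzero: "g \<noteq> (0, 0) \<Longrightarrow> map_coord g \<noteq> (0, 0)"
  by (cases g) (auto simp: map_coord_def)

text \<open>Applying \<sigma> to all coefficients of a representation by generators gives one at the
  conjugate point, since the curve equation is fixed.\<close>

lemma in_max_ideal_power_map:
  assumes "in_max_ideal_power F x0 y0 n g"
  shows "in_max_ideal_power F (\<sigma> x0) (\<sigma> y0) n (map_coord g)"
proof -
  let ?h = "map_poly (map_poly \<sigma>)"
  note hadd = map_poly_add_hom[of "map_poly \<sigma>", OF map_poly_0 map_add]
  note hmult = map_poly_mult_hom[of "map_poly \<sigma>", OF map_poly_0 map_add map_mult]
  have h1: "?h 1 = 1" by simp
  have hpow: "?h (p ^ n) = ?h p ^ n" for p n
    by (induction n) (simp_all add: hmult)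
  obtain c r where g: "bivariate g =
      (\<Sum>i\<le>n. c i * [:[:- x0, 1:]:] ^ i * [:[:- y0:], 1:] ^ (n - i)) + r * curve_eqn F"
    using assms unfolding in_max_ideal_power_def by blast
  have U: "?h [:[:- x0, 1:]:] = [:[:- \<sigma> x0, 1:]:]"
    by (simp add: map_poly_pCons minus)
  have V: "?h [:[:- y0:], 1:] = [:[:- \<sigma> y0:], 1:]"
    by (simp add: map_poly_pCons minus)
  have E: "?h (curve_eqn F) = curve_eqn F"
    by (simp add: curve_eqn_def map_poly_pCons map_minus F_fixed)
  have "bivariate (map_coord g) = ?h (bivariate g)"
    by (simp add: bivariate_def map_coord_def map_poly_pCons)
  also have "\<dots> = (\<Sum>i\<le>n. ?h (c i) * [:[:- \<sigma> x0, 1:]:] ^ i * [:[:- \<sigma> y0:], 1:] ^ (n - i))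
      + ?h r * curve_eqn F"
    unfolding g by (simp only: hadd hmult hpow sum_hom[of ?h, OF map_poly_0 hadd] U V E)
  finally show ?thesis
    unfolding in_max_ideal_power_def by (intro exI[of _ "\<lambda>i. ?h (c i)"] exI[of _ "?h r"])
qed

lemma map_hpoint_in_curve_points:
  assumes "P \<in> curve_points F"
  shows "map_hpoint \<sigma> P \<in> curve_points F"
proof (cases P)
  case (Affine x y)
  have "y ^ 2 = poly F x" using assms Affine by (auto simp: curve_points_def)
  hence "\<sigma> y ^ 2 = poly (map_poly \<sigma> F) (\<sigma> x)"
    by (simp add: poly_map_poly_hom[of \<sigma>, OF zero hom_add hom_mult] power[symmetric])
  thus ?thesis by (simp add: Affine curve_points_def F_fixed)
qed (simp add: curve_points_def)

end

context curve_automorphism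
begin

interpretation i: curve_automorphism \<tau> F by (rule inverse_automorphism)

lemma inv_apply [simp]: "\<tau> (\<sigma> x) = x" "\<sigma> (\<tau> x) = x"
  using bij by (simp_all add: bij_is_inj bij_is_surj surj_f_inv_f)

lemma inv_map_hpoint [simp]: "map_hpoint \<tau> (map_hpoint \<sigma> P) = P"
  "map_hpoint \<sigma> (map_hpoint \<tau> P) = P"
  by (cases P; simp)+

lemma inv_map_coord: "i.map_coord (map_coord g) = g"
  by (simp add: map_coord_def i.map_coord_def map_poly_map_poly o_def)

lemma ord_at_map: "ord_at F (map_hpoint \<sigma> P) (map_coord g) = ord_at F P g"
proof (cases P)
  case Infinity
  have "fst (map_coord g) ^ 2 - F * snd (map_coord g) ^ 2 = map_poly \<sigma> (fst g ^ 2 - F * snd g ^ 2)"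
    by (simp add: map_coord_def map_diff map_mult map_power F_fixed)
  hence "Polynomial.degree (fst (map_coord g) ^ 2 - F * snd (map_coord g) ^ 2) =
      Polynomial.degree (fst g ^ 2 - F * snd g ^ 2)"
    by (simp only:) (simp add: degree_map_poly)
  thus ?thesis by (simp add: Infinity)
next
  case (Affine x y)
  have "in_max_ideal_power F (\<sigma> x) (\<sigma> y) n (map_coord g) \<longleftrightarrow> in_max_ideal_power F x y n g" for n
    using in_max_ideal_power_map[of x y n g]
      i.in_max_ideal_power_map[of "\<sigma> x" "\<sigma> y" n "map_coord g"]
    by (auto simp: inv_map_coord)
  thus ?thesis by (simp add: Affine)
qed

lemma lookup_divisor_map:
  "Poly_Mapping.lookup (divisor_map \<sigma> \<Delta>) P = Poly_Mapping.lookup \<Delta> (map_hpoint \<tau> P)"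
proof -
  have eq: "P = map_hpoint \<sigma> Q \<longleftrightarrow> Q = map_hpoint \<tau> P" for Q
    by (metis inv_map_hpoint)
  have "Poly_Mapping.lookup (divisor_map \<sigma> \<Delta>) P =
      (\<Sum>Q\<in>Poly_Mapping.keys \<Delta>. Poly_Mapping.lookup \<Delta> Q * (if Q = map_hpoint \<tau> P then 1 else 0))"
    by (simp add: divisor_map_def frag_extend_def lookup_sum eq[symmetric] when_def)
  also have "\<dots> = Poly_Mapping.lookup \<Delta> (map_hpoint \<tau> P)"
    by (simp add: if_distrib in_keys_iff cong: if_cong)
  finally show ?thesis .
qed

lemma keys_divisor_map: "Poly_Mapping.keys (divisor_map \<sigma> \<Delta>) = map_hpoint \<sigma> ` Poly_Mapping.keys \<Delta>"
proof (intro equalityI subsetI)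
  fix P assume "P \<in> Poly_Mapping.keys (divisor_map \<sigma> \<Delta>)"
  hence "map_hpoint \<tau> P \<in> Poly_Mapping.keys \<Delta>"
    by (simp add: in_keys_iff lookup_divisor_map)
  thus "P \<in> map_hpoint \<sigma> ` Poly_Mapping.keys \<Delta>" by (metis imageI inv_map_hpoint(2))
qed (auto simp: in_keys_iff lookup_divisor_map)

lemma divisor_map_add: "divisor_map \<sigma> (a + b) = divisor_map \<sigma> a + divisor_map \<sigma> b"
  by (simp add: divisor_map_def frag_extend_add)

lemma divisor_map_minus: "divisor_map \<sigma> (- a) = - divisor_map \<sigma> a"
  by (simp add: divisor_map_def frag_extend_minus)

lemma divisor_map_in_principal_divisors:
  assumes "\<Delta> \<in> principal_divisors F"
  shows "divisor_map \<sigma> \<Delta> \<in> principal_divisors F"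
proof -
  obtain g h where \<Delta>: "\<Delta> \<in> carrier (Div0 F)" "g \<noteq> (0, 0)" "h \<noteq> (0, 0)"
    "\<And>P. P \<in> curve_points F \<Longrightarrow> Poly_Mapping.lookup \<Delta> P = ord_at F P g - ord_at F P h"
    using assms unfolding principal_divisors_def by blast
  have "inj_on (map_hpoint \<sigma>) A" for A
    by (rule inj_on_inverseI[of _ "map_hpoint \<tau>"]) simp
  hence "divisor_degree (divisor_map \<sigma> \<Delta>) = divisor_degree \<Delta>"
    by (simp add: divisor_degree_def keys_divisor_map sum.reindex lookup_divisor_map)
  hence "divisor_map \<sigma> \<Delta> \<in> carrier (Div0 F)"
    using \<Delta>(1) map_hpoint_in_curve_points by (auto simp: carrier_Div0 keys_divisor_map)
  moreover have "Poly_Mapping.lookup (divisor_map \<sigma> \<Delta>) P =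
      ord_at F P (map_coord g) - ord_at F P (map_coord h)" if "P \<in> curve_points F" for P
    using \<Delta>(4)[OF i.map_hpoint_in_curve_points[OF that]]
      ord_at_map[of "map_hpoint \<tau> P" g] ord_at_map[of "map_hpoint \<tau> P" h]
    by (simp add: lookup_divisor_map)
  ultimately show ?thesis
    unfolding principal_divisors_def
    using map_coord_nonzero[OF \<Delta>(2)] map_coord_nonzero[OF \<Delta>(3)] by blast
qed

end

lemma (in curve_automorphism) inv_divisor_map: "divisor_map \<sigma> (divisor_map \<tau> \<Delta>) = \<Delta>"
proof (rule poly_mapping_eqI)
  interpret j: curve_automorphism \<tau> F by (rule inverse_automorphism)
  fix P
  have "inv_into UNIV \<tau> = \<sigma>" using bij by (rule inv_inv_eq)
  thus "Poly_Mapping.lookup (divisor_map \<sigma> (divisor_map \<tau> \<Delta>)) P = Poly_Mapping.lookup \<Delta> P"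
    by (simp add: lookup_divisor_map j.lookup_divisor_map)
qed

lemma (in curve_automorphism) divisor_map_principal_divisors:
  "divisor_map \<sigma> ` principal_divisors F = principal_divisors F"
proof
  interpret i: curve_automorphism \<tau> F by (rule inverse_automorphism)
  show "principal_divisors F \<subseteq> divisor_map \<sigma> ` principal_divisors F"
  proof
    fix \<Delta> assume "\<Delta> \<in> principal_divisors F"
    hence "divisor_map \<tau> \<Delta> \<in> principal_divisors F"
      by (rule i.divisor_map_in_principal_divisors)
    thus "\<Delta> \<in> divisor_map \<sigma> ` principal_divisors F" by (metis imageI inv_divisor_map)
  qed
qed (use divisor_map_in_principal_divisors in auto)

lemma galois_curve_automorphism:
  assumes "\<sigma> \<in> galois_automorphisms"
  shows "curve_automorphism \<sigma> (map_poly to_ac f)"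
proof
  show add: "\<sigma> (x + y) = \<sigma> x + \<sigma> y" for x y using assms by (simp add: galois_automorphisms_def)
  have fixed: "\<sigma> (to_ac c) = to_ac c" for c using assms by (simp add: galois_automorphisms_def)
  have "\<sigma> 0 = 0" using add[of 0 0] by (metis add.right_neutral add_cancel_right_right)
  thus "map_poly \<sigma> (map_poly to_ac f) = map_poly to_ac f"
    by (simp add: map_poly_map_poly o_def fixed)
qed (use assms in \<open>auto simp: galois_automorphisms_def\<close>)

text \<open>\<open>divisor_map \<sigma>\<close> is additive, so taking images of cosets commutes
  with products and inverses. The neutral class is invariant because Galois permutes the principal
  divisors.\<close>

lemma subgroup_jacobian_points:
  fixes f :: "'k::field_char_0 poly"
  assumes F: "smooth_odd (map_poly to_ac f)"
  shows "subgroup (carrier (jacobian_points f)) (Pic0 (map_poly to_ac f))"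
proof -
  let ?F = "map_poly to_ac f"
  interpret D: comm_group "Div0 ?F" by (rule comm_group_Div0)
  note N = subgroup_principal_divisors[OF F]
  interpret N: normal "principal_divisors ?F" "Div0 ?F"
    by (rule D.subgroup_imp_normal[OF N])
  interpret P: comm_group "Pic0 ?F"
    unfolding Pic0_def by (rule D.abelian_FactGroup[OF N])
  have sub: "A \<subseteq> carrier (Div0 ?F)" if "A \<in> carrier (Pic0 ?F)" for A
    using that N.rcosets_carrier[OF D.is_group] by (auto simp: Pic0_def FactGroup_def)
  show ?thesis
  proof (rule P.subgroupI)
    show "carrier (jacobian_points f) \<subseteq> carrier (Pic0 ?F)"
      by (auto simp: jacobian_points_def)
    have "\<one>\<^bsub>Pic0 ?F\<^esub> \<in> carrier (jacobian_points f)"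
    proof -
      have "divisor_map \<sigma> ` (\<one>\<^bsub>Pic0 ?F\<^esub>) = \<one>\<^bsub>Pic0 ?F\<^esub>" if "\<sigma> \<in> galois_automorphisms" for \<sigma>
        using curve_automorphism.divisor_map_principal_divisors[OF galois_curve_automorphism[OF that]]
        by (simp add: Pic0_def)
      thus ?thesis by (simp add: jacobian_points_def)
    qed
    thus "carrier (jacobian_points f) \<noteq> {}" by blast
  next
    fix A assume A: "A \<in> carrier (jacobian_points f)"
    hence A': "A \<in> carrier (Pic0 ?F)" by (simp add: jacobian_points_def)
    have "inv\<^bsub>Pic0 ?F\<^esub> A = (\<Union>h\<in>A. {inv\<^bsub>Div0 ?F\<^esub> h})"
      using A' N.inv_FactGroup[of A] by (simp add: Pic0_def SET_INV_def)
    also have "\<dots> = uminus ` A"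
    proof -
      have "inv\<^bsub>Div0 ?F\<^esub> h = - h" if "h \<in> A" for h
        using sub[OF A'] that by (auto simp: inv_Div0)
      thus ?thesis by auto
    qed
    finally have inv: "inv\<^bsub>Pic0 ?F\<^esub> A = uminus ` A" .
    have "divisor_map \<sigma> ` (uminus ` A) = uminus ` A" if "\<sigma> \<in> galois_automorphisms" for \<sigma>
    proof -
      interpret curve_automorphism \<sigma> ?F by (rule galois_curve_automorphism[OF that])
      have "divisor_map \<sigma> ` A = A" using A that by (simp add: jacobian_points_def)
      moreover have "divisor_map \<sigma> ` (uminus ` A) = uminus ` (divisor_map \<sigma> ` A)"
        by (auto simp: image_image divisor_map_minus)
      ultimately show ?thesis by simp
    qed
    thus "inv\<^bsub>Pic0 ?F\<^esub> A \<in> carrier (jacobian_points f)"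
      using P.inv_closed[OF A'] unfolding inv by (simp add: jacobian_points_def)
  next
    fix A A' assume A: "A \<in> carrier (jacobian_points f)" "A' \<in> carrier (jacobian_points f)"
    hence "A \<otimes>\<^bsub>Pic0 ?F\<^esub> A' \<in> carrier (Pic0 ?F)" by (simp add: jacobian_points_def)
    moreover have "divisor_map \<sigma> ` (A \<otimes>\<^bsub>Pic0 ?F\<^esub> A') = A \<otimes>\<^bsub>Pic0 ?F\<^esub> A'"
      if "\<sigma> \<in> galois_automorphisms" for \<sigma>
    proof -
      interpret curve_automorphism \<sigma> ?F by (rule galois_curve_automorphism[OF that])
      have *: "divisor_map \<sigma> ` A = A" "divisor_map \<sigma> ` A' = A'"
        using A that by (simp_all add: jacobian_points_def)
      have "divisor_map \<sigma> ` (A \<otimes>\<^bsub>Pic0 ?F\<^esub> A') =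
          (divisor_map \<sigma> ` A) \<otimes>\<^bsub>Pic0 ?F\<^esub> (divisor_map \<sigma> ` A')"
        by (simp add: Pic0_def set_mult_def image_UN divisor_map_add)
      thus ?thesis by (simp only: *)
    qed
    ultimately show "A \<otimes>\<^bsub>Pic0 ?F\<^esub> A' \<in> carrier (jacobian_points f)"
      by (simp add: jacobian_points_def)
  qed
qed

text \<open>Its class is the image of the point under the Abel-Jacobi map with base point at
  infinity.\<close>

definition point_divisor :: "'a \<Rightarrow> 'a \<Rightarrow> 'a hpoint \<Rightarrow>\<^sub>0 int" where
  "point_divisor x y = frag_of (Affine x y) - frag_of Infinity"

text \<open>The class of a rational point minus infinity is Galois-invariant, and its
  \<open>n\<close>-th power is trivial only if the \<open>n\<close>-fold divisor is principal. A
  class of infinite order makes the rank positive.\<close>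

lemma mordell_weil_rank_pos_if_nontorsion:
  fixes f :: "'k::field_char_0 poly"
  defines "F \<equiv> map_poly to_ac f"
  assumes F: "smooth_odd F" and P: "y0 ^ 2 = poly f x0"
    and nontorsion: "\<And>n. n > 0 \<Longrightarrow>
      frag_cmul (int n) (point_divisor (to_ac x0) (to_ac y0)) \<notin> principal_divisors F"
  shows "mordell_weil_rank f > 0"
proof -
  let ?\<Delta> = "point_divisor (to_ac x0) (to_ac y0)"
  interpret D: comm_group "Div0 F" by (rule comm_group_Div0)
  note N = subgroup_principal_divisors[OF F]
  interpret N: normal "principal_divisors F" "Div0 F"
    by (rule D.subgroup_imp_normal[OF N])
  have Pic: "comm_group (Pic0 F)"
    unfolding Pic0_def by (rule D.abelian_FactGroup[OF N])
  interpret P: comm_group "Pic0 F" by (rule Pic)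
  have "to_ac y0 ^ 2 = poly F (to_ac x0)"
    using P by (simp add: F_def poly_map_poly_hom to_ac_power[symmetric] del: to_ac_power)
  hence "Poly_Mapping.keys ?\<Delta> \<subseteq> curve_points F"
    using keys_diff[of "frag_of (Affine (to_ac x0) (to_ac y0))" "frag_of Infinity"]
    by (auto simp: point_divisor_def curve_points_def)
  moreover have "divisor_degree ?\<Delta> = 0"
    unfolding point_divisor_def diff_conv_add_uminus divisor_degree_add divisor_degree_minus
    by (simp add: divisor_degree_def)
  ultimately have \<Delta>: "?\<Delta> \<in> carrier (Div0 F)" by (simp add: carrier_Div0)
  define \<xi> where "\<xi> = principal_divisors F #>\<^bsub>Div0 F\<^esub> ?\<Delta>"
  have coset: "A #>\<^bsub>Div0 F\<^esub> ?\<Delta> = (\<lambda>x. x + ?\<Delta>) ` A" for A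
    by (auto simp: r_coset_def)
  have \<xi>Pic: "\<xi> \<in> carrier (Pic0 F)"
    using \<Delta> by (simp add: \<xi>_def Pic0_def carrier_FactGroup)
  have "divisor_map \<sigma> ` \<xi> = \<xi>" if \<sigma>: "\<sigma> \<in> galois_automorphisms" for \<sigma>
  proof -
    interpret curve_automorphism \<sigma> F unfolding F_def by (rule galois_curve_automorphism[OF \<sigma>])
    \<comment> \<open>Both coordinates come from the base field, and infinity is fixed by every
      automorphism.\<close>
    have "divisor_map \<sigma> ?\<Delta> = ?\<Delta>"
      using \<sigma> by (simp add: point_divisor_def divisor_map_def frag_extend_diff galois_automorphisms_def)
    hence "divisor_map \<sigma> ` \<xi> = (divisor_map \<sigma> ` principal_divisors F) #>\<^bsub>Div0 F\<^esub> ?\<Delta>"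
      by (simp add: \<xi>_def coset image_image divisor_map_add)
    thus ?thesis by (simp add: divisor_map_principal_divisors \<xi>_def)
  qed
  hence \<xi>: "\<xi> \<in> carrier (jacobian_points f)"
    using \<xi>Pic by (simp add: jacobian_points_def F_def)
  have J: "jacobian_points f = (Pic0 F)\<lparr>carrier := carrier (jacobian_points f)\<rparr>"
    by (simp add: jacobian_points_def F_def)
  have sub: "subgroup (carrier (jacobian_points f)) (Pic0 F)"
    using subgroup_jacobian_points F unfolding F_def by blast
  have J_group: "comm_group (jacobian_points f)"
    using comm_group_subgroup[OF Pic sub] J by metis
  have "\<xi> [^]\<^bsub>jacobian_points f\<^esub> n \<noteq> \<one>\<^bsub>jacobian_points f\<^esub>" if "n > 0" for n :: nat
  proof
    assume "\<xi> [^]\<^bsub>jacobian_points f\<^esub> n = \<one>\<^bsub>jacobian_points f\<^esub>"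
    moreover have "\<xi> [^]\<^bsub>jacobian_points f\<^esub> n = \<xi> [^]\<^bsub>Pic0 F\<^esub> n"
      by (subst J) (simp add: nat_pow_def)
    moreover have "\<one>\<^bsub>jacobian_points f\<^esub> = principal_divisors F"
      by (subst J) (simp add: Pic0_def)
    moreover have "\<xi> [^]\<^bsub>Pic0 F\<^esub> n = principal_divisors F #>\<^bsub>Div0 F\<^esub> frag_cmul (int n) ?\<Delta>"
      unfolding \<xi>_def Pic0_def by (simp add: N.FactGroup_pow[OF \<Delta>] pow_Div0[OF \<Delta>])
    ultimately have "principal_divisors F #>\<^bsub>Div0 F\<^esub> frag_cmul (int n) ?\<Delta> = principal_divisors F"
      by simp
    moreover have "frag_cmul (int n) ?\<Delta> \<in> carrier (Div0 F)"
      using D.nat_pow_closed[OF \<Delta>, of n] by (simp add: pow_Div0[OF \<Delta>])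
    ultimately have "frag_cmul (int n) ?\<Delta> \<in> principal_divisors F"
      using D.coset_join1 N by blast
    thus False using nontorsion[OF that] by blast
  qed
  thus ?thesis
    unfolding mordell_weil_rank_def using abelian_rank_pos[OF J_group \<xi>] by blast
qed

section \<open>Torsion points and Pell equations\<close>

text \<open>After division by the full power of \<open>x - x0\<close> no root is left, so over an
  algebraically closed field the cofactor is constant.\<close>

lemma poly_with_unique_root:
  fixes N :: "'a::alg_closed_field poly"
  assumes "N \<noteq> 0" "\<And>x. poly N x = 0 \<Longrightarrow> x = x0"
  obtains c where "c \<noteq> 0" "N = Polynomial.smult c ([:- x0, 1:] ^ Polynomial.degree N)"
proof -
  obtain r where r: "N = [:- x0, 1:] ^ Polynomial.order x0 N * r" "\<not> [:- x0, 1:] dvd r"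
    using order_decomp[OF assms(1)] by blast
  have r0: "r \<noteq> 0" using r(2) by auto
  have "Polynomial.degree r = 0"
  proof (rule ccontr)
    assume "Polynomial.degree r \<noteq> 0"
    then obtain x where x: "poly r x = 0" using alg_closed_imp_poly_has_root[of r] by auto
    have "poly N x = 0" by (subst r(1)) (simp add: x)
    hence "x = x0" by (rule assms(2))
    thus False using r(2) x by (simp add: linear_dvd_iff)
  qed
  then obtain c where c: "r = [:c:]" by (rule degree_eq_zeroE)
  have N: "N = Polynomial.smult c ([:- x0, 1:] ^ Polynomial.order x0 N)"
    using r(1) by (simp add: c)
  have "c \<noteq> 0" using c r0 by auto
  moreover from this have "Polynomial.degree N = Polynomial.order x0 N"
    by (subst N) (simp add: degree_linear_power)
  ultimately show ?thesis using that[of c] N by simp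
qed

text \<open>A function \<open>G / H\<close> without affine poles is regular; this is the normality
  of the smooth affine curve. Each root of \<open>H\<close> gives a linear factor that also divides
  both components of \<open>G\<close>, and the degree of \<open>H\<close> drops by one.\<close>

lemma clear_denominator:
  fixes F :: "'a::{alg_closed_field, field_char_0} poly"
  assumes F: "smooth_odd F" and "H \<noteq> 0" "G \<noteq> (0, 0)"
    and "\<And>x y. y ^ 2 = poly F x \<Longrightarrow> ord_at F (Affine x y) (H, 0) \<le> ord_at F (Affine x y) G"
  shows "\<exists>G'. G = coord_mult F (H, 0) G'"
  using assms(2-)
proof (induction "Polynomial.degree H" arbitrary: H G)
  case 0
  then obtain c where c: "H = [:c:]" by (metis degree_eq_zeroE)
  hence "c \<noteq> 0" using 0 by auto
  thus ?case
    by (intro exI[of _ "(Polynomial.smult (1 / c) (fst G), Polynomial.smult (1 / c) (snd G))"])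
      (simp add: coord_mult_def c prod_eq_iff)
next
  case (Suc k)
  have "Polynomial.degree H > 0" using Suc by simp
  then obtain x where "poly H x = 0" using alg_closed_imp_poly_has_root[of H] by auto
  then obtain H1 where H1: "H = [:- x, 1:] * H1"
    by (auto simp: linear_dvd_iff[symmetric] elim: dvdE)
  hence H1_nz: "H1 \<noteq> 0" using Suc.prems by auto
  have "Suc k = Suc (Polynomial.degree H1)"
    using Suc.hyps(2) H1_nz unfolding H1 by (subst (asm) degree_mult_eq) auto
  hence k: "k = Polynomial.degree H1" by simp
  have mul: "(H, 0) = coord_mult F ([:- x, 1:], 0) (H1, 0)"
    by (simp add: coord_mult_def H1)
  have ord_H: "ord_at F (Affine a b) (H, 0) =
      ord_at F (Affine a b) ([:- x, 1:], 0) + ord_at F (Affine a b) (H1, 0)"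
    if "b ^ 2 = poly F a" for a b
    unfolding mul using that H1_nz by (intro ord_at_mult[OF F]) (auto simp: curve_points_def)
  obtain y where y: "y ^ 2 = poly F x" using nth_root_exists[of 2 "poly F x"] by auto
  have "[:- x, 1:] dvd fst G \<and> [:- x, 1:] dvd snd G"
  proof (rule linear_dvd_if_ord_at_ge[OF F y Suc.prems(2)])
    fix b assume b: "b ^ 2 = poly F x"
    have "ord_at F (Affine x b) (H1, 0) \<ge> 0" by simp
    thus "ord_at F (Affine x b) ([:- x, 1:], 0) \<le> ord_at F (Affine x b) G"
      using Suc.prems(3)[OF b] ord_H[OF b] by linarith
  qed
  then obtain p q where pq: "fst G = [:- x, 1:] * p" "snd G = [:- x, 1:] * q"
    by (auto elim!: dvdE)
  hence G: "G = coord_mult F ([:- x, 1:], 0) (p, q)"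
    by (simp add: coord_mult_def prod_eq_iff)
  have pq_nz: "(p, q) \<noteq> (0, 0)" using Suc.prems(2) pq by (auto simp: prod_eq_iff)
  have "\<exists>G'. (p, q) = coord_mult F (H1, 0) G'"
  proof (rule Suc.hyps(1)[OF k H1_nz pq_nz])
    fix a b assume b: "b ^ 2 = poly F a"
    have "ord_at F (Affine a b) G =
        ord_at F (Affine a b) ([:- x, 1:], 0) + ord_at F (Affine a b) (p, q)"
      unfolding G using b pq_nz by (intro ord_at_mult[OF F]) (auto simp: curve_points_def)
    thus "ord_at F (Affine a b) (H1, 0) \<le> ord_at F (Affine a b) (p, q)"
      using Suc.prems(3)[OF b] ord_H[OF b] by linarith
  qed
  then obtain G' where "(p, q) = coord_mult F (H1, 0) G'" by blast
  hence "G = coord_mult F (H, 0) G'"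
    unfolding G H1 by (simp add: coord_mult_def algebra_simps)
  thus ?case by blast
qed

text \<open>A function with divisor \<open>n (P - \<infinity>)\<close> has no affine pole, so it
  equals \<open>p + q y\<close>. Its only affine zero is \<open>P\<close>, so \<open>x0\<close> is
  the only root of its norm, and the pole at infinity gives the norm degree
  \<open>n\<close>.\<close>

lemma torsion_imp_pell:
  fixes F :: "'a::{alg_closed_field, field_char_0} poly"
  assumes F: "smooth_odd F" and P: "y0 ^ 2 = poly F x0" "y0 \<noteq> 0"
    and tors: "frag_cmul (int n) (point_divisor x0 y0) \<in> principal_divisors F"
  obtains p q c where "c \<noteq> 0" "p ^ 2 - F * q ^ 2 = Polynomial.smult c ([:- x0, 1:] ^ n)"
    "\<not> (poly p x0 = 0 \<and> poly q x0 = 0)"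
proof -
  have odd: "odd (Polynomial.degree F)" using F by (simp add: smooth_odd_def)
  obtain g h where gh: "g \<noteq> (0, 0)" "h \<noteq> (0, 0)"
    and ord: "\<And>Q. Q \<in> curve_points F \<Longrightarrow>
      Poly_Mapping.lookup (frag_cmul (int n) (point_divisor x0 y0)) Q = ord_at F Q g - ord_at F Q h"
    using tors unfolding principal_divisors_def by blast
  \<comment> \<open>Multiplying numerator and denominator by the conjugate of \<open>h\<close>
    leaves a denominator in \<open>x\<close> alone.\<close>
  define hc where "hc = (fst h, - snd h)"
  define H where "H = curve_norm F h"
  define G where "G = coord_mult F g hc"
  have H: "H \<noteq> 0" unfolding H_def by (rule curve_norm_nonzero[OF odd gh(2)])
  have hc: "hc \<noteq> (0, 0)" using gh(2) by (auto simp: hc_def prod_eq_iff)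
  have Hh: "(H, 0) = coord_mult F h hc"
    by (simp add: H_def curve_norm_def coord_mult_def hc_def power2_eq_square)
  have G: "G \<noteq> (0, 0)" unfolding G_def by (rule coord_mult_nonzero[OF odd gh(1) hc])
  have ordG: "ord_at F Q G - ord_at F Q (H, 0) =
      Poly_Mapping.lookup (frag_cmul (int n) (point_divisor x0 y0)) Q" if "Q \<in> curve_points F" for Q
    unfolding G_def Hh using ord_at_mult[OF F that gh(1) hc] ord_at_mult[OF F that gh(2) hc] ord[OF that]
    by linarith
  have lookup: "Poly_Mapping.lookup (frag_cmul (int n) (point_divisor x0 y0)) (Affine x y) =
      (if x = x0 \<and> y = y0 then int n else 0)" for x y
    by (auto simp: point_divisor_def lookup_minus)
  obtain G' where G': "G = coord_mult F (H, 0) G'"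
  proof -
    have "ord_at F (Affine x y) (H, 0) \<le> ord_at F (Affine x y) G" if "y ^ 2 = poly F x" for x y
      using ordG[of "Affine x y"] that unfolding lookup by (auto simp: curve_points_def split: if_splits)
    from clear_denominator[OF F H G this] show ?thesis using that by blast
  qed
  obtain p q where pq: "G' = (p, q)" by (cases G')
  have pq_nz: "(p, q) \<noteq> (0, 0)"
    using G unfolding G' pq by (auto simp: coord_mult_def)
  have ord': "ord_at F Q (p, q) =
      Poly_Mapping.lookup (frag_cmul (int n) (point_divisor x0 y0)) Q" if "Q \<in> curve_points F" for Q
    using ordG[OF that] ord_at_mult[OF F that _ pq_nz, of "(H, 0)"] H unfolding G' pq by simp
  have vanish: "x = x0 \<and> y = y0" if "y ^ 2 = poly F x" "poly p x + poly q x * y = 0" for x y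
  proof (rule ccontr)
    assume "\<not> (x = x0 \<and> y = y0)"
    hence "ord_at F (Affine x y) (p, q) = 0"
      using ord'[of "Affine x y"] that(1) lookup[of x y] by (auto simp: curve_points_def simp del: ord_at.simps)
    thus False using ord_at_affine_eq_0_iff[OF F that(1) pq_nz] that(2) by simp
  qed
  define N where "N = p ^ 2 - F * q ^ 2"
  have N_nz: "N \<noteq> 0" unfolding N_def by (rule degree_curve_norm(1)[OF odd pq_nz])
  have root: "x = x0" if "poly N x = 0" for x
  proof -
    obtain y where y: "y ^ 2 = poly F x" using nth_root_exists[of 2 "poly F x"] by auto
    have "(poly p x + poly q x * y) * (poly p x + poly q x * (- y)) = 0"
      using that by (simp add: N_def y[symmetric] power2_eq_square algebra_simps)
    thus ?thesis using vanish[OF y] vanish[of "- y" x] y by auto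
  qed
  have "ord_at F Infinity (p, q) = - int n"
    using ord'[of Infinity] by (simp add: curve_points_def point_divisor_def lookup_minus del: ord_at.simps)
  hence "Polynomial.degree N = n" by (simp add: N_def)
  moreover obtain c where "c \<noteq> 0" "N = Polynomial.smult c ([:- x0, 1:] ^ Polynomial.degree N)"
    using poly_with_unique_root[OF N_nz root] .
  \<comment> \<open>Otherwise the function would also vanish at \<open>(x0, - y0)\<close>, which
    differs from \<open>P\<close> because \<open>y0 \<noteq> 0\<close>.\<close>
  moreover have "\<not> (poly p x0 = 0 \<and> poly q x0 = 0)"
  proof
    assume "poly p x0 = 0 \<and> poly q x0 = 0"
    hence "- y0 = y0" using vanish[of "- y0" x0] P(1) by simp
    thus False using P(2) by simp
  qed
  ultimately show ?thesis using that[of c p q] by (simp add: N_def)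
qed

text \<open>
  A \<open>K\<close>-linear functional, applied coefficientwise, turns a solution over the algebraic closure of
  a linear system over \<open>K\<close> into a solution over \<open>K\<close>.
\<close>

lemma functional_exists:
  fixes z :: "'k::field alg_closure"
  assumes "z \<noteq> 0"
  obtains \<phi> :: "'k alg_closure \<Rightarrow> 'k" where
    "\<And>x y. \<phi> (x + y) = \<phi> x + \<phi> y" "\<And>c x. \<phi> (to_ac c * x) = c * \<phi> x" "\<phi> z \<noteq> 0"
proof -
  interpret vector_space_pair "\<lambda>c (x :: 'k alg_closure). to_ac c * x" "(*) :: 'k \<Rightarrow> 'k \<Rightarrow> 'k"
    by unfold_locales (simp_all add: algebra_simps)
  have "vs1.independent {z}" using assms by simp
  from linear_independent_extend[OF this, of "\<lambda>_. 1"] obtain \<phi>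
    where \<phi>: "Vector_Spaces.linear (\<lambda>c x. to_ac c * x) (*) \<phi>" "\<phi> z = 1" by auto
  show ?thesis
    using that[of \<phi>] linear_add[OF \<phi>(1)] linear_scale[OF \<phi>(1)] \<phi>(2) by simp
qed

lemma map_poly_functional_mult:
  fixes \<phi> :: "'k::field alg_closure \<Rightarrow> 'k"
  assumes "\<And>x y. \<phi> (x + y) = \<phi> x + \<phi> y" "\<And>c x. \<phi> (to_ac c * x) = c * \<phi> x"
  shows "map_poly \<phi> (map_poly to_ac s * p) = s * map_poly \<phi> p"
proof -
  have 0: "\<phi> 0 = 0" using assms(2)[of 0 0] by simp
  show ?thesis
    by (rule poly_eqI) (simp add: coeff_map_poly coeff_mult 0 sum_hom[of \<phi>, OF 0 assms(1)] assms(2))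
qed

text \<open>The Pell equation is quadratic and does not survive a linear functional. The condition
  \<open>(x - x0)^n dvd p + S q\<close>, with \<open>S\<close> a square root of \<open>f\<close>
  modulo \<open>(x - x0)^n\<close>, is linear over the base field; with the degree bounds it forces
  the norm to be a multiple of \<open>(x - x0)^n\<close> of degree at most \<open>n\<close>.\<close>

lemma pell_descent:
  fixes f :: "'k::field_char_0 poly"
  defines "F \<equiv> map_poly to_ac f"
  assumes odd: "odd (Polynomial.degree f)" and P: "y0 ^ 2 = poly f x0" "y0 \<noteq> 0" and n: "n > 0"
    and pell: "p ^ 2 - F * q ^ 2 = Polynomial.smult c ([:- to_ac x0, 1:] ^ n)" "c \<noteq> 0"
    and prim: "\<not> (poly p (to_ac x0) = 0 \<and> poly q (to_ac x0) = 0)"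
  obtains p' q' c' where "c' \<noteq> 0" "p' ^ 2 - f * q' ^ 2 = Polynomial.smult c' ([:- x0, 1:] ^ n)"
    "\<not> (poly p' x0 = 0 \<and> poly q' x0 = 0)"
proof -
  let ?h = "map_poly to_ac"
  define l where "l = [:- x0, 1:]"
  define L where "L = [:- to_ac x0, 1:]"
  have l_nz: "l \<noteq> 0" by (simp add: l_def)
  have deg_l: "Polynomial.degree (l ^ i) = i" and deg_L: "Polynomial.degree (L ^ i) = i" for i
    by (simp_all add: l_def L_def degree_linear_power)
  note pell = pell[folded L_def]
  note hadd = map_poly_add_hom[of to_ac, OF to_ac_0 to_ac_add]
  note hmult = map_poly_mult_hom[of to_ac, OF to_ac_0 to_ac_add to_ac_mult]
  have hpow: "?h (s ^ k) = ?h s ^ k" for s :: "'k poly" and k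
    by (induction k) (simp_all add: hmult)
  have hlin: "?h l = L" by (simp add: l_def L_def map_poly_pCons)
  have hdiff: "?h (s - t) = ?h s - ?h t" for s t :: "'k poly"
    by (rule poly_eqI) (simp add: coeff_map_poly)
  have hpoly: "poly (?h s) (to_ac x0) = to_ac (poly s x0)" for s :: "'k poly"
    by (rule poly_map_poly_hom) simp_all
  have degF: "Polynomial.degree F = Polynomial.degree f"
    by (simp add: F_def degree_map_poly)
  obtain S where S: "poly S x0 = y0" "l ^ n dvd f - S ^ 2"
    using sqrt_poly_mod_exists[OF P, of n, folded l_def] by blast
  obtain R where R: "f - S ^ 2 = l ^ n * R" using S(2) by (rule dvdE)
  have FS: "F - ?h S ^ 2 = L ^ n * ?h R"
    using arg_cong[OF R, of ?h] by (simp only: hdiff hmult hpow hlin F_def)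
  have "(p - ?h S * q) * (p + ?h S * q) = (p ^ 2 - F * q ^ 2) + (F - ?h S ^ 2) * q ^ 2"
    by (simp add: power2_eq_square algebra_simps)
  also have "\<dots> = L ^ n * ([:c:] + ?h R * q ^ 2)"
    unfolding pell(1) FS by (simp add: algebra_simps)
  finally have dvd: "L ^ n dvd (p - ?h S * q) * (p + ?h S * q)" by simp
  \<comment> \<open>\<open>p - S q\<close> and \<open>p + S q\<close> cannot both vanish at
    \<open>x0\<close>, so one of them carries the whole power. The sign of \<open>q\<close> is
    adjusted to make it the second one.\<close>
  obtain q1 where q1: "q1 = q \<or> q1 = - q" "L ^ n dvd p + ?h S * q1"
  proof (cases "poly (p - ?h S * q) (to_ac x0) = 0")
    case True
    have "poly (p + ?h S * q) (to_ac x0) \<noteq> 0"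
    proof
      assume "poly (p + ?h S * q) (to_ac x0) = 0"
      with True have "poly p (to_ac x0) = to_ac y0 * poly q (to_ac x0)"
        "2 * (to_ac y0 * poly q (to_ac x0)) = 0"
        by (simp_all add: hpoly S(1) algebra_simps)
      thus False using prim P(2) by auto
    qed
    hence "L ^ n dvd p - ?h S * q"
      using linear_power_dvd_cancel[of "to_ac x0" n "p + ?h S * q" "p - ?h S * q", folded L_def] dvd
      by (simp add: mult.commute)
    thus ?thesis using that[of "- q"] by simp
  next
    case False
    thus ?thesis using that[of q] linear_power_dvd_cancel[of "to_ac x0" n, folded L_def, OF dvd] by simp
  qed
  have norm1: "p ^ 2 - F * q1 ^ 2 = Polynomial.smult c (L ^ n)" using q1(1) pell(1) by auto
  have nz1: "(p, q1) \<noteq> (0, 0)" using prim q1(1) by auto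
  have deg1: "Polynomial.degree (p ^ 2 - F * q1 ^ 2) = n"
    unfolding norm1 using pell(2) by (simp add: deg_L)
  have oddF: "odd (Polynomial.degree F)" using odd degF by simp
  \<comment> \<open>The functional is chosen non-zero at some coefficient of \<open>p\<close> or
    \<open>q1\<close>, so that the images are not both 0.\<close>
  obtain z i where z: "z \<noteq> 0" "z = coeff p i \<or> z = coeff q1 i"
  proof (cases "p = 0")
    case True
    hence "q1 \<noteq> 0" using nz1 by simp
    thus ?thesis using that[of "Polynomial.lead_coeff q1"] by auto
  next
    case False
    thus ?thesis using that[of "Polynomial.lead_coeff p"] by auto
  qed
  obtain \<phi> :: "'k alg_closure \<Rightarrow> 'k" where \<phi>: "\<And>x y. \<phi> (x + y) = \<phi> x + \<phi> y"
    "\<And>c x. \<phi> (to_ac c * x) = c * \<phi> x" "\<phi> z \<noteq> 0"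
    using functional_exists[OF z(1)] by blast
  have \<phi>0: "\<phi> 0 = 0" using \<phi>(2)[of 0 0] by simp
  define p' q' where "p' = map_poly \<phi> p" and "q' = map_poly \<phi> q1"
  have nz: "(p', q') \<noteq> (0, 0)"
  proof
    assume "(p', q') = (0, 0)"
    hence "coeff p' i = 0" "coeff q' i = 0" by simp_all
    thus False using z(2) \<phi>(3) by (auto simp: p'_def q'_def coeff_map_poly \<phi>0)
  qed
  obtain T where T: "p + ?h S * q1 = L ^ n * T" using q1(2) by (rule dvdE)
  have "map_poly \<phi> (p + ?h S * q1) = p' + S * q'"
    by (simp add: map_poly_add_hom[of \<phi>, OF \<phi>0 \<phi>(1)] map_poly_functional_mult[of \<phi>, OF \<phi>(1,2)]
        p'_def q'_def)
  moreover have "map_poly \<phi> (L ^ n * T) = l ^ n * map_poly \<phi> T"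
    using map_poly_functional_mult[of \<phi>, OF \<phi>(1,2), of "l ^ n" T] by (simp only: hpow hlin)
  ultimately have T': "p' + S * q' = l ^ n * map_poly \<phi> T" using T by simp
  define N where "N = p' ^ 2 - f * q' ^ 2"
  have N_nz: "N \<noteq> 0" unfolding N_def by (rule degree_curve_norm(1)[OF odd nz])
  have "N = (p' + S * q') * (p' - S * q') - (f - S ^ 2) * q' ^ 2"
    by (simp add: N_def power2_eq_square algebra_simps)
  also have "\<dots> = l ^ n * (map_poly \<phi> T * (p' - S * q') - R * q' ^ 2)"
    unfolding T' R by (simp only: right_diff_distrib mult.assoc)
  finally obtain r where r: "N = l ^ n * r" by blast
  have degN: "Polynomial.degree N \<le> n"
    unfolding N_def
  proof (rule degree_diff_le)
    have "Polynomial.degree p' \<le> Polynomial.degree p"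
      by (simp add: p'_def map_poly_degree_leq)
    moreover have "2 * Polynomial.degree p \<le> n"
      using degree_curve_norm(2)[OF oddF nz1] deg1 by simp
    ultimately show "Polynomial.degree (p' ^ 2) \<le> n"
      using degree_power_le[of p' 2] by linarith
    show "Polynomial.degree (f * q' ^ 2) \<le> n"
    proof (cases "q' = 0")
      case False
      hence "q1 \<noteq> 0" by (auto simp: q'_def)
      hence "2 * Polynomial.degree q1 + Polynomial.degree f \<le> n"
        using degree_curve_norm(3)[OF oddF nz1] deg1 degF by simp
      moreover have "Polynomial.degree q' \<le> Polynomial.degree q1"
        by (simp add: q'_def map_poly_degree_leq)
      ultimately show ?thesis
        using degree_mult_le[of f "q' ^ 2"] degree_power_le[of q' 2] by linarith
    qed simp
  qed
  have r_nz: "r \<noteq> 0" using N_nz r by auto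
  have "Polynomial.degree N = n + Polynomial.degree r"
    unfolding r using r_nz l_nz by (subst degree_mult_eq) (simp_all add: deg_l)
  hence degN': "Polynomial.degree N = n" "Polynomial.degree r = 0" using degN by simp_all
  then obtain c' where c': "r = [:c':]" by (metis degree_eq_zeroE)
  have "c' \<noteq> 0" using r_nz c' by auto
  moreover have "p' ^ 2 - f * q' ^ 2 = Polynomial.smult c' (l ^ n)"
    using r by (simp add: N_def c')
  \<comment> \<open>A common factor \<open>l\<close> would give \<open>N = l^2 N2\<close>, with
    \<open>N2\<close> still divisible by \<open>l^(n - 1)\<close>. Then \<open>N\<close> would have
    degree at least \<open>n + 1\<close>.\<close>
  moreover have "\<not> (poly p' x0 = 0 \<and> poly q' x0 = 0)"
  proof
    assume "poly p' x0 = 0 \<and> poly q' x0 = 0"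
    then obtain p2 q2 where p2: "p' = l * p2" "q' = l * q2"
      by (auto simp: linear_dvd_iff[symmetric] l_def elim!: dvdE)
    obtain k where k: "n = Suc k" using n by (cases n) auto
    have "l * (p2 + S * q2) = l * (l ^ k * map_poly \<phi> T)"
      using T' by (simp only: p2 k power_Suc mult.assoc distrib_left mult.left_commute)
    hence T2: "p2 + S * q2 = l ^ k * map_poly \<phi> T"
      using l_nz by simp
    define N2 where "N2 = p2 ^ 2 - f * q2 ^ 2"
    have N2: "N = l ^ 2 * N2" 
      unfolding N_def N2_def p2 power_mult_distrib by (simp only: right_diff_distrib mult.left_commute)
    have "N2 = (p2 + S * q2) * (p2 - S * q2) - (f - S ^ 2) * q2 ^ 2"
      by (simp add: N2_def power2_eq_square algebra_simps)
    also have "\<dots> = l ^ k * (map_poly \<phi> T * (p2 - S * q2) - l * R * q2 ^ 2)"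
      unfolding T2 R k by (simp only: right_diff_distrib mult.assoc power_Suc2)
    finally have dvd2: "l ^ k dvd N2" by simp
    have N2_nz: "N2 \<noteq> 0" using N_nz N2 by auto
    have "k \<le> Polynomial.degree N2"
      using dvd_imp_degree_le[OF dvd2 N2_nz] by (simp add: deg_l)
    moreover have "Polynomial.degree N = 2 + Polynomial.degree N2"
      unfolding N2 using N2_nz by (subst degree_mult_eq) (simp_all add: deg_l l_nz)
    ultimately show False using degN'(1) k by simp
  qed
  ultimately show ?thesis unfolding l_def by (rule that)
qed

section \<open>Derivations\<close>

definition derivation :: "('a::comm_ring_1 \<Rightarrow> 'a) \<Rightarrow> bool" where
  "derivation d \<longleftrightarrow> (\<forall>x y. d (x + y) = d x + d y) \<and> (\<forall>x y. d (x * y) = d x * y + x * d y)"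

lemma derivation_add: "derivation d \<Longrightarrow> d (x + y) = d x + d y"
  and derivation_mult: "derivation d \<Longrightarrow> d (x * y) = d x * y + x * d y"
  by (simp_all add: derivation_def)

lemma derivation_0: "derivation d \<Longrightarrow> d 0 = 0"
  using derivation_mult[of d 0 0] by simp

lemma derivation_1: "derivation d \<Longrightarrow> d 1 = 0"
  using derivation_mult[of d 1 1] by simp

lemma derivation_minus: "derivation d \<Longrightarrow> d (- x) = - d x"
  using derivation_add[of d x "- x"] by (simp add: derivation_0 eq_neg_iff_add_eq_0 add.commute)

lemma derivation_diff: "derivation d \<Longrightarrow> d (x - y) = d x - d y"
  using derivation_add[of d x "- y"] by (simp add: derivation_minus)

lemma derivation_power: "derivation d \<Longrightarrow> d (x ^ Suc n) = of_nat (Suc n) * x ^ n * d x"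
proof (induction n)
  case (Suc n)
  have "d (x ^ Suc (Suc n)) = d x * x ^ Suc n + x * d (x ^ Suc n)"
    using derivation_mult[OF Suc.prems, of x "x ^ Suc n"] by simp
  thus ?case unfolding Suc.IH[OF Suc.prems] by (simp add: algebra_simps)
qed simp

lemma derivation_square: "derivation d \<Longrightarrow> d (x ^ 2) = 2 * x * d x"
  by (simp add: power2_eq_square derivation_mult algebra_simps)

lemma derivation_divide:
  fixes d :: "'a::field \<Rightarrow> 'a"
  assumes "derivation d" "y \<noteq> 0"
  shows "d (x / y) = (d x * y - x * d y) / y ^ 2"
proof -
  have "d x = d (x / y) * y + (x / y) * d y"
    using derivation_mult[OF assms(1), of "x / y" y] assms(2) by simp
  thus ?thesis using assms(2) by (simp add: field_simps power2_eq_square)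
qed

text \<open>The derivation of \<open>K[x]\<close> that extends \<open>d\<close> and maps \<open>x\<close> to \<open>\<theta> x\<close>.\<close>

definition poly_derivation :: "('a::idom \<Rightarrow> 'a) \<Rightarrow> 'a \<Rightarrow> 'a poly \<Rightarrow> 'a poly" where
  "poly_derivation d \<theta> p = map_poly d p + Polynomial.smult \<theta> (pCons 0 (pderiv p))"

context
  fixes d :: "'a::idom \<Rightarrow> 'a" and \<theta> :: 'a
  assumes d: "derivation d"
begin

private abbreviation \<delta> :: "'a poly \<Rightarrow> 'a poly" where "\<delta> \<equiv> poly_derivation d \<theta>"

lemma coeff_poly_derivation: "coeff (\<delta> p) i = d (coeff p i) + of_nat i * \<theta> * coeff p i"
  by (cases i) (simp_all add: poly_derivation_def coeff_map_poly derivation_0[OF d] coeff_pCons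
      coeff_pderiv algebra_simps)

lemma derivation_poly_derivation: "derivation \<delta>"
proof -
  have "\<delta> (p + q) = \<delta> p + \<delta> q" for p q
    by (rule poly_eqI) (simp add: coeff_poly_derivation derivation_add[OF d] algebra_simps)
  moreover have "\<delta> (p * q) = \<delta> p * q + p * \<delta> q" for p q
  proof (rule poly_eqI)
    fix n
    have "coeff (\<delta> (p * q)) n = (\<Sum>i\<le>n. d (coeff p i * coeff q (n - i)))
        + of_nat n * \<theta> * (\<Sum>i\<le>n. coeff p i * coeff q (n - i))"
      by (simp add: coeff_poly_derivation coeff_mult sum_hom[of d, OF derivation_0[OF d] derivation_add[OF d]])
    also have "\<dots> = (\<Sum>i\<le>n. coeff (\<delta> p) i * coeff q (n - i) + coeff p i * coeff (\<delta> q) (n - i))"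
      unfolding sum_distrib_left sum.distrib[symmetric]
      by (intro sum.cong refl)
        (simp add: coeff_poly_derivation derivation_mult[OF d] algebra_simps of_nat_diff)
    also have "\<dots> = coeff (\<delta> p * q + p * \<delta> q) n"
      by (simp add: coeff_mult sum.distrib)
    finally show "coeff (\<delta> (p * q)) n = coeff (\<delta> p * q + p * \<delta> q) n" .
  qed
  ultimately show ?thesis by (simp add: derivation_def)
qed

lemma degree_poly_derivation_le: "Polynomial.degree (\<delta> p) \<le> Polynomial.degree p"
  by (rule degree_le) (simp add: coeff_poly_derivation coeff_eq_0 derivation_0[OF d])

end

text \<open>For \<open>g = p + q y\<close> the fraction \<open>B / N\<close> is the
  \<open>y\<close>-coefficient of \<open>\<delta>(g) / g\<close>. As the pole at \<open>x0\<close>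
  is at most simple, \<open>(x - x0)^(n - 1)\<close> divides \<open>B\<close>, and the degree bounds
  leave only \<open>B = 0\<close>. Then \<open>p \<delta>(N) = 2 \<delta>(p) N\<close>, which fails
  at \<open>x0\<close> after cancelling \<open>(x - x0)^(n - 1)\<close>.\<close>

lemma pell_no_solution:
  fixes f :: "'k::field_char_0 poly"
  assumes d: "derivation d" and odd: "odd (Polynomial.degree f)" "Polynomial.degree f \<ge> 3"
    and f: "poly_derivation d \<theta> f = Polynomial.smult \<kappa> f"
    and x0: "poly f x0 \<noteq> 0" "\<theta> * x0 \<noteq> d x0"
    and n: "n > 0" and c: "c \<noteq> 0"
    and pell: "p ^ 2 - f * q ^ 2 = Polynomial.smult c ([:- x0, 1:] ^ n)"
    and prim: "\<not> (poly p x0 = 0 \<and> poly q x0 = 0)"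
  shows False
proof -
  define l where "l = [:- x0, 1:]"
  define \<delta> where "\<delta> = poly_derivation d \<theta>"
  have D: "derivation \<delta>" unfolding \<delta>_def by (rule derivation_poly_derivation[OF d])
  define N where "N = p ^ 2 - f * q ^ 2"
  \<comment> \<open>The coefficient of \<open>y\<close> in \<open>\<delta>(g)\<close>: applying
    \<delta> to \<open>y^2 = f\<close> forces \<open>\<delta>(y) = \<kappa> y / 2\<close>.\<close>
  define qs where "qs = \<delta> q + Polynomial.smult (\<kappa> / 2) q"
  \<comment> \<open>The coefficient of \<open>y\<close> in \<open>\<delta>(g) (p - q y)\<close>, where \<open>g = p + q y\<close> and \<open>\<delta>(y) = \<kappa> y / 2\<close>.\<close>
  define B where "B = p * qs - q * \<delta> p"
  \<comment> \<open>The value of \<open>\<delta>(x - x0)\<close> at \<open>x0\<close>, non-zero by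
    hypothesis.\<close>
  define \<eta> where "\<eta> = \<theta> * x0 - d x0"
  obtain k where k: "n = Suc k" using n by (cases n) auto
  have px0: "poly p x0 \<noteq> 0"
  proof
    assume "poly p x0 = 0"
    moreover have "poly (p ^ 2 - f * q ^ 2) x0 = 0" unfolding pell using n by simp
    ultimately show False using x0(1) prim by simp
  qed
  have half: "Polynomial.smult (\<kappa> / 2) q * 2 = Polynomial.smult \<kappa> q"
    by (rule poly_eqI) (simp add: mult.commute[of _ 2] numeral_poly)
  have dN: "\<delta> N = 2 * (p * \<delta> p - f * q * qs)"
  proof -
    have "\<delta> N = 2 * p * \<delta> p - (\<delta> f * q ^ 2 + f * (2 * q * \<delta> q))"
      unfolding N_def by (simp add: derivation_diff[OF D] derivation_mult[OF D] derivation_square[OF D])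
    also have "\<delta> f = Polynomial.smult \<kappa> f" using f by (simp add: \<delta>_def)
    also have "Polynomial.smult \<kappa> f * q ^ 2 = f * q * (Polynomial.smult (\<kappa> / 2) q * 2)"
      unfolding half by (simp add: power2_eq_square mult.assoc)
    finally show ?thesis by (simp add: qs_def algebra_simps)
  qed
  have 1: "2 * (p * B) = 2 * (qs * N) - q * \<delta> N"
    unfolding dN unfolding B_def N_def by (simp add: power2_eq_square algebra_simps)
  have 2: "2 * (q * f * B) = 2 * (\<delta> p * N) - p * \<delta> N"
    unfolding dN unfolding B_def N_def by (simp add: power2_eq_square algebra_simps)
  have dl: "\<delta> l = Polynomial.smult \<theta> l + [:\<eta>:]"
    by (simp add: \<delta>_def poly_derivation_def map_poly_pCons derivation_0[OF d] derivation_1[OF d]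
        derivation_minus[OF d] pderiv_pCons \<eta>_def l_def)
  have dc: "\<delta> [:c:] = [:d c:]"
    by (simp add: \<delta>_def poly_derivation_def map_poly_pCons derivation_0[OF d])
  \<comment> \<open>\<delta> removes only one factor \<open>l\<close> from \<open>N = c l^n\<close>;
    \<open>M\<close> is the remaining cofactor.\<close>
  define M where "M = Polynomial.smult (d c) l + Polynomial.smult (c * of_nat n) (Polynomial.smult \<theta> l + [:\<eta>:])"
  have N_eq: "N = [:c:] * l ^ n" unfolding N_def pell l_def by simp
  have "\<delta> N = [:d c:] * l ^ Suc k + [:c:] * (of_nat n * l ^ k * (Polynomial.smult \<theta> l + [:\<eta>:]))"
    unfolding N_eq k derivation_mult[OF D] derivation_power[OF D] dl dc ..
  also have "\<dots> = l ^ k * M"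
    unfolding M_def by (simp add: of_nat_poly smult_add_right distrib_left ac_simps)
  finally have dN': "\<delta> N = l ^ k * M" .
  have "p * (2 * B) = l ^ k * (2 * (qs * [:c:] * l) - q * M)"
    using 1 unfolding dN' unfolding N_eq k by (simp add: algebra_simps)
  hence "l ^ k dvd p * (2 * B)" by simp
  hence dvdB: "l ^ k dvd 2 * B" using px0 unfolding l_def by (rule linear_power_dvd_cancel)
  have nz: "(p, q) \<noteq> (0, 0)" using prim by auto
  have degN: "Polynomial.degree (p ^ 2 - f * q ^ 2) = n"
    unfolding pell using c by (simp add: degree_linear_power)
  have "B = 0"
  proof (cases "q = 0")
    case True
    thus ?thesis by (simp add: B_def qs_def derivation_0[OF D])
  next
    case False
    have deg: "2 * Polynomial.degree p \<le> n" "2 * Polynomial.degree q + 3 \<le> n"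
      using degree_curve_norm(2,3)[OF odd(1) nz] False degN odd(2) by simp_all
    have "Polynomial.degree (\<delta> p) \<le> Polynomial.degree p" "Polynomial.degree (\<delta> q) \<le> Polynomial.degree q"
      unfolding \<delta>_def by (rule degree_poly_derivation_le[OF d])+
    moreover from this have "Polynomial.degree qs \<le> Polynomial.degree q"
      unfolding qs_def by (intro degree_add_le) auto
    ultimately have "Polynomial.degree (p * qs) \<le> Polynomial.degree p + Polynomial.degree q"
      "Polynomial.degree (q * \<delta> p) \<le> Polynomial.degree p + Polynomial.degree q"
      using degree_mult_le[of p qs] degree_mult_le[of q "\<delta> p"] by linarith+
    hence "Polynomial.degree B \<le> Polynomial.degree p + Polynomial.degree q"
      unfolding B_def by (rule degree_diff_le)
    hence "Polynomial.degree (2 * B) \<le> Polynomial.degree p + Polynomial.degree q"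
      using degree_mult_le[of "2 :: 'k poly" B] by simp
    \<comment> \<open>Adding the two bounds gives \<open>deg p + deg q \<le> n - 2\<close>, while
      \<open>k = n - 1\<close>. Positive genus enters here, as the 3 in the second bound.\<close>
    hence less: "Polynomial.degree (2 * B) < k" using deg k by linarith
    have "2 * B = 0"
    proof (rule ccontr)
      assume "2 * B \<noteq> 0"
      from dvd_imp_degree_le[OF dvdB this] less show False by (simp add: degree_linear_power l_def)
    qed
    thus ?thesis by simp
  qed
  hence "l ^ k * (p * M) = l ^ k * (2 * (\<delta> p * [:c:] * l))"
    using 2 unfolding dN' unfolding N_eq k by (simp add: algebra_simps)
  hence "p * M = 2 * (\<delta> p * [:c:] * l)"
    by (subst (asm) mult_cancel_left) (auto simp: l_def)
  hence "poly (p * M) x0 = poly (2 * (\<delta> p * [:c:] * l)) x0" by simp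
  moreover have lx: "poly l x0 = 0" by (simp add: l_def)
  moreover have "poly M x0 = c * of_nat n * \<eta>" by (simp add: M_def lx)
  ultimately have "poly p x0 * (c * of_nat n * \<eta>) = 0" by simp
  thus False using px0 c n x0(2) by (simp add: \<eta>_def)
qed

section \<open>The common twist\<close>

lemma degree_binomial:
  assumes "A \<noteq> 0" "m > 0"
  shows "Polynomial.degree (Polynomial.monom A m + [:B:]) = m"
  using assms by (subst degree_add_eq_left) (simp_all add: degree_monom_eq)

lemma smooth_odd_binomial:
  fixes A B :: "'a::field_char_0"
  assumes "A \<noteq> 0" "B \<noteq> 0" "odd m"
  shows "smooth_odd (Polynomial.monom A m + [:B:])"
proof -
  have m: "m > 0" using assms(3) by (cases m) auto
  have "x \<noteq> 0" if "poly (Polynomial.monom A m + [:B:]) x = 0" for x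
    using that m assms(2) by (auto simp: poly_monom zero_power)
  thus ?thesis
    using assms m by (auto simp: smooth_odd_def degree_binomial pderiv_add pderiv_monom poly_monom pderiv_pCons)
qed

text \<open>The constants \<kappa> and \<theta> are chosen so that the extended derivation scales
  \<open>B\<close> and \<open>A x^m\<close> by the same factor \<open>d B / B\<close>. It remains to
  see that the abscissa is not carried along by it.\<close>

lemma binomial_rank_pos:
  fixes A B x0 y0 :: "'k::field_char_0"
  assumes d: "derivation d" and AB: "A \<noteq> 0" "B \<noteq> 0" and m: "odd m" "m \<ge> 3"
    and P: "y0 ^ 2 = A * x0 ^ m + B" "y0 \<noteq> 0" and nonconst: "d (y0 ^ 2 / B) \<noteq> 0"
  shows "mordell_weil_rank (Polynomial.monom A m + [:B:]) > 0"
proof -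
  define f where "f = Polynomial.monom A m + [:B:]"
  define F where "F = map_poly to_ac f"
  have P': "y0 ^ 2 = poly f x0" using P(1) by (simp add: f_def poly_monom)
  have deg: "Polynomial.degree f = m" unfolding f_def using AB m by (intro degree_binomial) auto
  have "F = Polynomial.monom (to_ac A) m + [:to_ac B:]"
    by (simp add: F_def f_def map_poly_add_hom map_poly_monom map_poly_pCons)
  hence F: "smooth_odd F" using smooth_odd_binomial[of "to_ac A" "to_ac B" m] AB m by simp
  define \<kappa> where "\<kappa> = d B / B"
  define \<theta> where "\<theta> = (\<kappa> - d A / A) / of_nat m"
  have m0: "(of_nat m :: 'k) \<noteq> 0" using m by auto
  have m\<theta>: "of_nat m * \<theta> * A = \<kappa> * A - d A"
    using m0 AB by (simp add: \<theta>_def field_simps)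
  have df: "poly_derivation d \<theta> f = Polynomial.smult \<kappa> f"
  proof (rule poly_eqI)
    fix i
    consider "i = 0" | "i = m" "i \<noteq> 0" | "i \<noteq> 0" "i \<noteq> m" by blast
    thus "coeff (poly_derivation d \<theta> f) i = coeff (Polynomial.smult \<kappa> f) i"
    proof cases
      case 1
      thus ?thesis using m AB by (simp add: coeff_poly_derivation[OF d] f_def \<kappa>_def)
    next
      case 2
      hence "coeff f i = A" by (cases i) (auto simp: f_def)
      thus ?thesis using 2 m\<theta> by (simp add: coeff_poly_derivation[OF d])
    next
      case 3
      hence "coeff f i = 0" by (cases i) (auto simp: f_def)
      thus ?thesis by (simp add: coeff_poly_derivation[OF d] derivation_0[OF d])
    qed
  qed
  \<comment> \<open>If \<open>d x0 = \<theta> x0\<close>, then \<open>A x0^m\<close> and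
    \<open>B\<close> are both scaled by \<kappa>, hence so is \<open>y0^2\<close>, and
    \<open>y0^2 / B\<close> would be killed by \<open>d\<close>.\<close>
  have x0: "\<theta> * x0 \<noteq> d x0"
  proof
    assume *: "\<theta> * x0 = d x0"
    obtain k where k: "m = Suc k" using m by (cases m) auto
    have "d (x0 ^ m) = of_nat m * \<theta> * x0 ^ m"
      unfolding k derivation_power[OF d] *[symmetric] by (simp add: algebra_simps)
    hence "d (y0 ^ 2) = d A * x0 ^ m + (of_nat m * \<theta> * A) * x0 ^ m + d B"
      unfolding P(1) derivation_add[OF d] derivation_mult[OF d] by (simp add: algebra_simps)
    also have "\<dots> = \<kappa> * A * x0 ^ m + \<kappa> * B"
      unfolding m\<theta> using AB by (simp add: algebra_simps \<kappa>_def)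
    also have "\<dots> = \<kappa> * y0 ^ 2" unfolding P(1) by (simp add: algebra_simps)
    finally have "d (y0 ^ 2) * B - y0 ^ 2 * d B = 0"
      using AB by (simp add: \<kappa>_def)
    thus False using nonconst by (simp add: derivation_divide[OF d AB(2)])
  qed
  show ?thesis
    unfolding f_def[symmetric]
  proof (rule mordell_weil_rank_pos_if_nontorsion[OF F[unfolded F_def] P'], rule notI)
    fix n :: nat
    assume n: "n > 0" and tors: "frag_cmul (int n) (point_divisor (to_ac x0) (to_ac y0))
        \<in> principal_divisors (map_poly to_ac f)"
    have PL: "to_ac y0 ^ 2 = poly F (to_ac x0)" "to_ac y0 \<noteq> 0"
      using P' P(2) by (simp_all add: F_def poly_map_poly_hom to_ac_power[symmetric] del: to_ac_power)
    obtain p q c where pell: "c \<noteq> 0"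
      "p ^ 2 - map_poly to_ac f * q ^ 2 = Polynomial.smult c ([:- to_ac x0, 1:] ^ n)"
      "\<not> (poly p (to_ac x0) = 0 \<and> poly q (to_ac x0) = 0)"
      using torsion_imp_pell[OF F PL, of n] tors unfolding F_def by blast
    have odd: "odd (Polynomial.degree f)" "Polynomial.degree f \<ge> 3" using deg m by simp_all
    obtain p' q' c' where "c' \<noteq> 0" "p' ^ 2 - f * q' ^ 2 = Polynomial.smult c' ([:- x0, 1:] ^ n)"
      "\<not> (poly p' x0 = 0 \<and> poly q' x0 = 0)"
      using pell_descent[OF odd(1) P' P(2) n pell(2,1,3)] .
    moreover have "poly f x0 \<noteq> 0" using P' P(2) by (metis power_not_zero)
    ultimately show False
      using pell_no_solution[OF d odd df _ x0 n] by blast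
  qed
qed

text \<open>The inequalities for \<open>s\<close> keep \<open>D'\<close>, \<open>w\<close>, the
  ordinates and the required derivatives from vanishing. All four curves are treated with one
  derivation that kills \<open>a\<close>, \<open>b\<close>, \<open>c\<close>, \<open>e\<close> but
  not \<open>t\<close>, so everything depends on \<open>s\<close> alone.\<close>

lemma common_twist_exists:
  fixes m1 m2 m3 m4 :: nat and a b c e t :: "'k::field_char_0" and d :: "'k \<Rightarrow> 'k"
  defines "p \<equiv> 1 / a ^ 2" and "q \<equiv> 1 / b ^ 2" and "s \<equiv> t ^ (2 * m3) / c ^ 2"
  assumes m: "odd m1" "m1 \<ge> 3" "odd m2" "m2 \<ge> 3" "odd m3" "m3 \<ge> 3" "odd m4" "m4 \<ge> 3"
    and d: "derivation d" "d a = 0" "d b = 0" "d c = 0" "d e = 0" "d t \<noteq> 0"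
    and nz: "a \<noteq> 0" "b \<noteq> 0" "c \<noteq> 0" "e \<noteq> 0" "t \<noteq> 0"
    and s: "s \<noteq> p - q" "s \<noteq> q - p" "s \<noteq> p + q" "(p - q) ^ 2 - 2 * (p + q) * s + s ^ 2 \<noteq> 0"
      "e * ((p - q) ^ 2 - 2 * (p + q) * s + s ^ 2) + 4 * p * q * s \<noteq> 0"
  shows "\<exists>D. D \<noteq> 0 \<and> mordell_weil_rank (m_twist m1 (a ^ 2) D) > 0 \<and>
    mordell_weil_rank (m_twist m2 (b ^ 2) D) > 0 \<and> mordell_weil_rank (m_twist m3 (c ^ 2) D) > 0 \<and>
    mordell_weil_rank (two_m_twist m4 e D) > 0"
proof -
  have pq: "p \<noteq> 0" "q \<noteq> 0" and s0: "s \<noteq> 0" using nz by (simp_all add: p_def q_def s_def)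
  \<comment> \<open>The tangent at \<open>(0, 1)\<close> to
    \<open>Y^2 = (1 + p X) (1 + q X) (1 + s X)\<close> meets the curve again at this abscissa: with
    slope \<open>(p + q + s) / 2\<close>, comparing the coefficients of \<open>X^2\<close> and
    \<open>X^3\<close> gives it.\<close>
  define D' where "D' = ((p - q) ^ 2 - 2 * (p + q) * s + s ^ 2) / (4 * p * q * s)"
  define w where "w = e * D' + 1"
  define M where "M = m1 * m2 * m3 * m4"
  define D where "D = D' / w ^ M"
  have D'0: "D' \<noteq> 0" using s pq s0 by (simp add: D'_def)
  have "w = (e * ((p - q) ^ 2 - 2 * (p + q) * s + s ^ 2) + 4 * p * q * s) / (4 * p * q * s)"
    using pq s0 by (simp add: w_def D'_def field_simps)
  hence w0: "w \<noteq> 0" using s(5) pq s0 by simp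
  have D0: "D \<noteq> 0" using D'0 w0 by (simp add: D_def)
  have D1: "1 + p * D' = (p - q - s) ^ 2 / (4 * q * s)" "1 + q * D' = (q - p - s) ^ 2 / (4 * p * s)"
    "1 + s * D' = (s - p - q) ^ 2 / (4 * p * q)"
    using pq s0 by (simp_all add: D'_def field_simps power2_eq_square)
  have dconst: "d (x ^ 2) = 0" if "d x = 0" for x
    using that by (simp add: derivation_square[OF d(1)])
  have dp: "d p = 0" and dq: "d q = 0"
    using nz d dconst by (simp_all add: p_def q_def derivation_divide[OF d(1)] derivation_1[OF d(1)])
  obtain k where k: "2 * m3 = Suc k" using m by (cases "2 * m3") auto
  have "d s = d (t ^ (2 * m3)) / c ^ 2"
    using nz d(4) dconst by (simp add: s_def derivation_divide[OF d(1)] field_simps power2_eq_square)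
  also have "\<dots> = of_nat (Suc k) * t ^ k * d t / c ^ 2"
    unfolding k derivation_power[OF d(1)] ..
  finally have ds: "d s \<noteq> 0" using nz d(6) by (simp del: of_nat_Suc)
  have dnum: "d 4 = 0" "d 2 = 0"
  proof -
    have "d 2 = 0" using derivation_add[OF d(1), of 1 1] derivation_1[OF d(1)] by simp
    thus "d 4 = 0" "d 2 = 0" using derivation_add[OF d(1), of 2 2] by simp_all
  qed
  note drules = derivation_divide[OF d(1)] derivation_mult[OF d(1)] derivation_square[OF d(1)]
    derivation_add[OF d(1)] derivation_diff[OF d(1)] derivation_1[OF d(1)] dp dq dnum d(5)
  have ne: "p - q - s \<noteq> 0" "q - p - s \<noteq> 0" "s - p - q \<noteq> 0" "p - q + s \<noteq> 0"
    using s(1-3) by (auto simp: algebra_simps)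
  have sm: "s = (t ^ m3 / c) ^ 2"
    by (simp add: s_def power_divide power_mult[symmetric] mult.commute)
  have wM: "(w ^ (M div mi)) ^ mi = w ^ M" if "mi dvd M" for mi
    using that by (simp add: power_mult[symmetric])
  have dvdM: "m1 dvd M" "m2 dvd M" "m3 dvd M" "m4 dvd M" by (simp_all add: M_def)
  have "mordell_weil_rank (Polynomial.monom D m1 + [:a ^ 2:]) > 0"
  proof (rule binomial_rank_pos[OF d(1) D0 _ m(1,2)])
    \<comment> \<open>A square root of \<open>a^2 (1 + p D')\<close>, since \<open>4 q s\<close> is
      the square of \<open>2 t^m3 / (b c)\<close>.\<close>
    let ?y = "a * (p - q - s) * b * c / (2 * t ^ m3)"
    have y: "?y ^ 2 / a ^ 2 = (p - q - s) ^ 2 / (4 * q * s)"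
      unfolding sm q_def using nz by (simp add: field_simps power2_eq_square)
    have "D * (w ^ (M div m1)) ^ m1 + a ^ 2 = a ^ 2 * (1 + p * D')"
      unfolding wM[OF dvdM(1)] D_def p_def using w0 nz by (simp add: field_simps)
    thus "?y ^ 2 = D * (w ^ (M div m1)) ^ m1 + a ^ 2"
      unfolding D1 y[symmetric] using nz by simp
    show "a ^ 2 \<noteq> 0" "?y \<noteq> 0" using nz ne by simp_all
    have "d (?y ^ 2 / a ^ 2) = - ((p - q - s) * (p - q + s)) * d s / (4 * q * s ^ 2)"
      unfolding y using pq s0 by (simp add: drules) (simp add: field_simps power2_eq_square)
    thus "d (?y ^ 2 / a ^ 2) \<noteq> 0" using ne ds pq s0 by simp
  qed
  moreover have "mordell_weil_rank (Polynomial.monom D m2 + [:b ^ 2:]) > 0"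
  proof (rule binomial_rank_pos[OF d(1) D0 _ m(3,4)])
    let ?y = "b * (q - p - s) * a * c / (2 * t ^ m3)"
    have y: "?y ^ 2 / b ^ 2 = (q - p - s) ^ 2 / (4 * p * s)"
      unfolding sm p_def using nz by (simp add: field_simps power2_eq_square)
    have "D * (w ^ (M div m2)) ^ m2 + b ^ 2 = b ^ 2 * (1 + q * D')"
      unfolding wM[OF dvdM(2)] D_def q_def using w0 nz by (simp add: field_simps)
    thus "?y ^ 2 = D * (w ^ (M div m2)) ^ m2 + b ^ 2"
      unfolding D1 y[symmetric] using nz by simp
    show "b ^ 2 \<noteq> 0" "?y \<noteq> 0" using nz ne by simp_all
    have "d (?y ^ 2 / b ^ 2) = (q - p - s) * (p - q - s) * d s / (4 * p * s ^ 2)"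
      unfolding y using pq s0 by (simp add: drules) (simp add: field_simps power2_eq_square)
    thus "d (?y ^ 2 / b ^ 2) \<noteq> 0" using ne ds pq s0 by simp
  qed
  moreover have "mordell_weil_rank (Polynomial.monom D m3 + [:c ^ 2:]) > 0"
  proof (rule binomial_rank_pos[OF d(1) D0 _ m(5,6)])
    let ?y = "c * (s - p - q) * a * b / 2"
    have y: "?y ^ 2 / c ^ 2 = (s - p - q) ^ 2 / (4 * p * q)"
      unfolding p_def q_def using nz by (simp add: field_simps power2_eq_square)
    \<comment> \<open>As \<open>c^2 s = (t^2)^m3\<close>, the factor \<open>s\<close> is absorbed
      into the abscissa; this is the reason for the exponent \<open>2 * m3\<close> in
      \<open>s\<close>.\<close>
    have "D * (t ^ 2 * w ^ (M div m3)) ^ m3 + c ^ 2 = c ^ 2 * (1 + s * D')"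
      unfolding power_mult_distrib wM[OF dvdM(3)] D_def s_def power_mult
      using w0 nz by (simp add: field_simps)
    thus "?y ^ 2 = D * (t ^ 2 * w ^ (M div m3)) ^ m3 + c ^ 2"
      unfolding D1 y[symmetric] using nz by simp
    show "c ^ 2 \<noteq> 0" "?y \<noteq> 0" using nz ne by simp_all
    have "d (?y ^ 2 / c ^ 2) = (s - p - q) * d s / (2 * p * q)"
      unfolding y using pq s0 by (simp add: drules) (simp add: field_simps power2_eq_square)
    thus "d (?y ^ 2 / c ^ 2) \<noteq> 0" using ne ds pq s0 by simp
  qed
  moreover have "odd M" using m by (simp add: M_def)
  then obtain j where j: "M = 2 * j + 1" by (rule oddE)
  have "mordell_weil_rank (Polynomial.monom 1 m4 + [:e * D:]) > 0"
  proof (rule binomial_rank_pos[OF d(1) _ _ m(7,8)])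
    let ?y = "1 / w ^ j"
    have y2: "?y ^ 2 = w / w ^ M"
      using w0 by (simp add: j power_mult[symmetric] power_divide mult.commute)
    have "(1 / w ^ (M div m4)) ^ m4 = 1 / w ^ M"
      by (simp add: power_divide wM[OF dvdM(4)])
    thus "?y ^ 2 = 1 * (1 / w ^ (M div m4)) ^ m4 + e * D"
      unfolding y2 by (simp add: D_def w_def add_divide_distrib)
    show "(1::'k) \<noteq> 0" "e * D \<noteq> 0" "?y \<noteq> 0" using nz D0 w0 by simp_all
    \<comment> \<open>The power of \<open>w\<close> cancels, so it suffices that \<open>D'\<close>
      is not killed by \<open>d\<close>.\<close>
    have y: "?y ^ 2 / (e * D) = 1 + 1 / (e * D')"
      unfolding y2 D_def using w0 nz D'0 by (simp add: field_simps w_def)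
    have "d D' = (s - p + q) * (s + p - q) * d s / (4 * p * q * s ^ 2)"
      unfolding D'_def using pq s0 by (simp add: drules) (simp add: field_simps power2_eq_square)
    moreover have "s - p + q \<noteq> 0" "s + p - q \<noteq> 0" using s(1,2) by (auto simp: algebra_simps)
    ultimately have "d D' \<noteq> 0" using ds pq s0 by simp
    moreover have "d (1 + 1 / (e * D')) = - d D' / (e * D' ^ 2)"
      using nz D'0 by (simp add: drules) (simp add: field_simps power2_eq_square)
    ultimately show "d (?y ^ 2 / (e * D)) \<noteq> 0" unfolding y using nz D'0 by simp
  qed
  ultimately show ?thesis
    using D0 by (auto simp: m_twist_def two_m_twist_def)
qed

section \<open>The rational function field and its derivation\<close>

instance fract :: ("{idom, ring_char_0}") field_char_0
proof
  show "inj (of_nat :: nat \<Rightarrow> 'a fract)"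
    by (rule injI) (simp add: of_nat_fract eq_fract)
qed

text \<open>The cross-multiplied difference is a combination of the relation
  \<open>a b' = a' b\<close> and its derivative.\<close>

lemma quotient_rule_well_defined:
  fixes D :: "'a::idom \<Rightarrow> 'a"
  assumes D: "derivation D" and nz: "b \<noteq> 0" "b' \<noteq> 0" and eq: "Fract a b = Fract a' b'"
  shows "Fract (D a * b - a * D b) (b ^ 2) = Fract (D a' * b' - a' * D b') (b' ^ 2)"
proof -
  have 1: "a * b' = a' * b" using eq nz by (simp add: eq_fract)
  have 2: "D a * b' + a * D b' = D a' * b + a' * D b"
    using arg_cong[OF 1, of D] by (simp add: derivation_mult[OF D])
  have "(D a * b - a * D b) * b' ^ 2 = (D a' * b' - a' * D b') * b ^ 2"
  proof -
    have "(D a * b - a * D b) * b' ^ 2 - (D a' * b' - a' * D b') * b ^ 2 =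
        b * b' * ((D a * b' + a * D b') - (D a' * b + a' * D b))
        - (a * b' - a' * b) * (b' * D b + b * D b')"
      by (simp add: power2_eq_square algebra_simps)
    thus ?thesis by (simp add: 1 2)
  qed
  thus ?thesis using nz by (simp add: eq_fract)
qed

lemma derivation_fract_exists:
  fixes D :: "'a::idom \<Rightarrow> 'a"
  assumes D: "derivation D"
  obtains d :: "'a fract \<Rightarrow> 'a fract" where "derivation d" "\<And>x. d (to_fract x) = to_fract (D x)"
proof -
  \<comment> \<open>The quotient rule for a chosen representation as a fraction; the preceding lemma
    makes the choice irrelevant.\<close>
  define d where "d z = (SOME w. \<exists>a b. b \<noteq> 0 \<and> z = Fract a b \<and> w = Fract (D a * b - a * D b) (b ^ 2))"
    for z
  have d: "d (Fract a b) = Fract (D a * b - a * D b) (b ^ 2)" if "b \<noteq> 0" for a b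
  proof -
    have "\<exists>w a' b'. b' \<noteq> 0 \<and> Fract a b = Fract a' b' \<and> w = Fract (D a' * b' - a' * D b') (b' ^ 2)"
      using that by blast
    from someI_ex[OF this] obtain a' b' where "b' \<noteq> 0" "Fract a b = Fract a' b'"
      "d (Fract a b) = Fract (D a' * b' - a' * D b') (b' ^ 2)"
      unfolding d_def by blast
    thus ?thesis using quotient_rule_well_defined[OF D that, of b' a a'] by simp
  qed
  have "d (x + y) = d x + d y \<and> d (x * y) = d x * y + x * d y" for x y
  proof -
    obtain a b where x: "x = Fract a b" "b \<noteq> 0" by (cases x)
    obtain a' b' where y: "y = Fract a' b'" "b' \<noteq> 0" by (cases y)
    show ?thesis
      using x(2) y(2) unfolding x(1) y(1)
      by (simp add: d eq_fract derivation_add[OF D] derivation_mult[OF D] power2_eq_square algebra_simps)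
  qed
  hence "derivation d" by (simp add: derivation_def)
  moreover have "d (to_fract x) = to_fract (D x)" for x
    by (simp add: to_fract_def d derivation_1[OF D])
  ultimately show ?thesis by (rule that)
qed

lemma derivation_pderiv: "derivation (pderiv :: 'a::idom poly \<Rightarrow> 'a poly)"
  by (simp add: derivation_def pderiv_add pderiv_mult algebra_simps)

lemma rat_const_add: "rat_const (x + y) = rat_const x + rat_const y"
  and rat_const_mult: "rat_const (x * y) = rat_const x * rat_const y"
  by (simp_all add: rat_const_def to_fract_add[symmetric] to_fract_mult[symmetric]
      del: to_fract_add to_fract_mult)

lemma rat_const_1 [simp]: "rat_const 1 = 1"
  by (simp add: rat_const_def one_pCons[symmetric])

lemma rat_const_eq_0_iff [simp]: "rat_const x = 0 \<longleftrightarrow> x = 0"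
  by (simp add: rat_const_def)

lemma rat_const_minus: "rat_const (- x) = - rat_const x"
  by (simp add: rat_const_def to_fract_uminus[symmetric] del: to_fract_uminus)

lemma rat_const_diff: "rat_const (x - y) = rat_const x - rat_const y"
  using rat_const_add[of x "- y"] by (simp add: rat_const_minus)

lemma rat_const_power: "rat_const (x ^ n) = rat_const x ^ n"
  by (induction n) (simp_all add: rat_const_mult)

lemma rat_const_divide: "rat_const (x / y) = rat_const x / rat_const y"
proof (cases "y = 0")
  case False
  thus ?thesis using rat_const_mult[of "x / y" y] by (simp add: field_simps)
qed (simp add: rat_const_def)

lemma rat_const_numeral: "rat_const (numeral k) = numeral k"
proof -
  have "rat_const (of_nat n) = of_nat n" for n
    by (induction n) (simp_all add: rat_const_add rat_const_def[of 0])
  from this[of "numeral k"] show ?thesis by simp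
qed

text \<open>The outermost polynomial variable, the one that \<open>pderiv\<close>
  differentiates.\<close>

definition v3 :: ratfun4 where "v3 = to_fract [:0, 1:]"

text \<open>\<open>v3\<close> is transcendental over the rationals: the exponents 0,
  \<open>k\<close> and \<open>2 k\<close> are distinct, so coefficients can be compared.\<close>

lemma v3_quadratic:
  assumes "rat_const x + rat_const y * v3 ^ k + rat_const z * (v3 ^ k) ^ 2 = 0" "k > 0"
  shows "x = 0 \<and> y = 0 \<and> z = 0"
proof -
  let ?C = "\<lambda>x :: rat. [:[:[:x:]:]:]"
  have pow: "v3 ^ n = to_fract (Polynomial.monom 1 n)" for n
    by (induction n) (simp_all add: v3_def to_fract_mult[symmetric] monom_Suc del: to_fract_mult)
  have "to_fract ([:?C x:] + [:?C y:] * Polynomial.monom 1 k + [:?C z:] * Polynomial.monom 1 (2 * k)) = 0"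
    using assms(1) unfolding power_mult[symmetric]
    by (simp only: pow rat_const_def to_fract_add to_fract_mult mult.commute[of k 2])
  hence 0: "[:?C x:] + Polynomial.monom (?C y) k + Polynomial.monom (?C z) (2 * k) = 0"
    unfolding to_fract_eq_0_iff by (simp add: smult_monom)
  have "coeff ([:?C x:] + Polynomial.monom (?C y) k + Polynomial.monom (?C z) (2 * k)) i = 0" for i
    unfolding 0 by simp
  from this[of 0] this[of k] this[of "2 * k"] show ?thesis
    using assms(2) by (cases k) (auto simp: coeff_pCons)
qed

theorem theorem4p1:
  fixes m1 m2 m3 m4 :: nat and a b c d :: rat
  assumes "odd m1" "m1 \<ge> 3" and "odd m2" "m2 \<ge> 3" and "odd m3" "m3 \<ge> 3" and "odd m4" "m4 \<ge> 3"
    and "a \<noteq> 0" and "b \<noteq> 0" and "c \<noteq> 0" and "d \<noteq> 0"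
  shows "\<exists>D :: ratfun4. D \<noteq> 0 \<and>
           mordell_weil_rank (m_twist m1 (rat_const (a ^ 2)) D) > 0 \<and>
           mordell_weil_rank (m_twist m2 (rat_const (b ^ 2)) D) > 0 \<and>
           mordell_weil_rank (m_twist m3 (rat_const (c ^ 2)) D) > 0 \<and>
           mordell_weil_rank (two_m_twist m4 (rat_const d) D) > 0"
proof -
  \<comment> \<open>Partial differentiation with respect to \<open>v3\<close>, which kills all
    rational constants.\<close>
  obtain der :: "ratfun4 \<Rightarrow> ratfun4" where der: "derivation der" "\<And>x. der (to_fract x) = to_fract (pderiv x)"
    using derivation_fract_exists[OF derivation_pderiv] by blast
  have const: "der (rat_const x) = 0" for x
    by (simp add: rat_const_def der(2) pderiv_pCons)
  have t: "der v3 \<noteq> 0" "v3 \<noteq> 0"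
    by (simp_all add: v3_def der(2) pderiv_pCons)
  define p q where "p = 1 / a ^ 2" and "q = 1 / b ^ 2"
  have p: "1 / rat_const a ^ 2 = rat_const p" and q: "1 / rat_const b ^ 2 = rat_const q"
    by (simp_all add: p_def q_def rat_const_divide rat_const_power)
  define T where "T = v3 ^ (2 * m3)"
  have trans: "x = 0 \<and> y = 0 \<and> z = 0"
    if "rat_const x + rat_const y * T + rat_const z * T ^ 2 = 0" for x y z
    using that v3_quadratic[of x y "2 * m3" z] assms unfolding T_def by simp
  let ?s = "T / rat_const c ^ 2"
  have c0: "rat_const c \<noteq> 0" using assms by simp
  have ne: "?s \<noteq> rat_const r" for r
  proof
    assume "?s = rat_const r"
    hence "rat_const (- r * c ^ 2) + rat_const 1 * T + rat_const 0 * T ^ 2 = 0"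
      using c0 by (simp add: rat_const_mult rat_const_minus rat_const_power field_simps)
    from trans[OF this] show False by simp
  qed
  \<comment> \<open>Multiplication by \<open>c^4\<close> turns a quadratic relation in
    \<open>s\<close> into one in \<open>T\<close>. Only its leading coefficient matters: it is 1 in
    \<open>s1\<close> and \<open>d\<close> in \<open>s2\<close>.\<close>
  have quad: "e = 0" if "rat_const e * ?s ^ 2 + rat_const g * ?s + rat_const h = 0" for e g h
  proof -
    have "rat_const (h * c ^ 4) + rat_const (g * c ^ 2) * T + rat_const e * T ^ 2 =
        rat_const c ^ 4 * (rat_const e * ?s ^ 2 + rat_const g * ?s + rat_const h)"
      using c0 by (simp add: rat_const_mult rat_const_power field_simps power2_eq_square power4_eq_xxxx)
    hence "rat_const (h * c ^ 4) + rat_const (g * c ^ 2) * T + rat_const e * T ^ 2 = 0"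
      using that by simp
    from trans[OF this] show ?thesis by simp
  qed
  have s1: "(rat_const p - rat_const q) ^ 2 - 2 * (rat_const p + rat_const q) * ?s + ?s ^ 2 \<noteq> 0"
  proof
    assume "(rat_const p - rat_const q) ^ 2 - 2 * (rat_const p + rat_const q) * ?s + ?s ^ 2 = 0"
    hence "rat_const 1 * ?s ^ 2 + rat_const (- 2 * (p + q)) * ?s + rat_const ((p - q) ^ 2) = 0"
      by (simp add: rat_const_mult rat_const_minus rat_const_add rat_const_diff rat_const_power
          rat_const_numeral algebra_simps)
    from quad[OF this] show False by simp
  qed
  have s2: "rat_const d * ((rat_const p - rat_const q) ^ 2 - 2 * (rat_const p + rat_const q) * ?s + ?s ^ 2)
      + 4 * rat_const p * rat_const q * ?s \<noteq> 0"
  proof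
    assume "rat_const d * ((rat_const p - rat_const q) ^ 2 - 2 * (rat_const p + rat_const q) * ?s + ?s ^ 2)
      + 4 * rat_const p * rat_const q * ?s = 0"
    hence "rat_const d * ?s ^ 2 + rat_const (4 * p * q - 2 * d * (p + q)) * ?s
        + rat_const (d * (p - q) ^ 2) = 0"
      by (simp add: rat_const_mult rat_const_minus rat_const_add rat_const_diff rat_const_power
          rat_const_numeral algebra_simps)
    from quad[OF this] show False using assms by simp
  qed
  have "\<exists>D. D \<noteq> 0 \<and> mordell_weil_rank (m_twist m1 (rat_const a ^ 2) D) > 0 \<and>
      mordell_weil_rank (m_twist m2 (rat_const b ^ 2) D) > 0 \<and>
      mordell_weil_rank (m_twist m3 (rat_const c ^ 2) D) > 0 \<and>
      mordell_weil_rank (two_m_twist m4 (rat_const d) D) > 0"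
  proof (rule common_twist_exists[OF assms(1-8) der(1) const const const const t(1) _ _ _ _ t(2)])
    show "rat_const a \<noteq> 0" "rat_const b \<noteq> 0" "rat_const c \<noteq> 0" "rat_const d \<noteq> 0"
      using assms by simp_all
  qed (unfold p q T_def[symmetric], use ne[of "p - q"] ne[of "q - p"] ne[of "p + q"] s1 s2
      in \<open>simp_all add: rat_const_diff rat_const_add\<close>)
  thus ?thesis by (simp only: rat_const_power)
qed

end
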